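(* Let $\Sigma$ be a $d\times d$ positive-definite matrix with $(2\pi)^{d/2}\sqrt{\det\Sigma}=1$, and let $X$ be the Gaussian DPP on $\mathbb{R}^d$ with scattering matrix $\Sigma$. For $R>0$ let $N$ be the (random) number of points of $X$ lying in the closed Euclidean ball $B(R)$ of radius $R$ centred at the origin, and let $n=\mathbb{E}[N]$. Then $$n=|B(R)|=|B(1)|R^d,$$ where $|B(t)|$ denotes the Lebesgue volume of the Euclidean ball of radius $t$, and for every $\varepsilon>0$, $$\mathbb{P}\Big[\Big|\frac{N}{n}-1\Big|\ge\varepsilon\Big]\le 2\exp\Big(-\frac{3\varepsilon^2}{6+2\varepsilon}|B(R)|\Big).$$
   Context: The Gaussian DPP with scattering matrix $\Sigma$ (a $d\times d$ positive-definite matrix) is the stationary determinantal point process on $\mathbb{R}^d$ with background measure Lebesgue measure and kernel $K(x,y)=\frac{1}{(2\pi)^{d/2}\sqrt{\det\Sigma}}\exp(-\frac12(x-y)^\top\Sigma^{-1}(x-y))$; i.e. its $k$-point correlation functions are $\rho_k(x_1,\dots,x_k)=\det[K(x_i,x_j)]_{i,j=1}^k$. Under the normalization $(2\pi)^{d/2}\sqrt{\det\Sigma}=1$ the kernel is $K(x,y)=\exp(-\frac12(x-y)^\top\Sigma^{-1}(x-y))$ and the mean density of points is $1$. *)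

theory Defs
  imports "HOL-Probability.Probability" "HOL-Combinatorics.Permutations"
begin

definition pos_def_matrix :: "real^'n^'n \<Rightarrow> bool" where
  "pos_def_matrix S \<longleftrightarrow> transpose S = S \<and> (\<forall>x. x \<noteq> 0 \<longrightarrow> x \<bullet> (S *v x) > 0)"

definition gauss_kernel :: "real^'n^'n \<Rightarrow> real^'n \<Rightarrow> real^'n \<Rightarrow> real" where
  "gauss_kernel S x y =
     exp (-(1/2) * ((x - y) \<bullet> (matrix_inv S *v (x - y))))
     / ((2 * pi) powr (real CARD('n) / 2) * sqrt (det S))"

definition kernel_det :: "('a \<Rightarrow> 'a \<Rightarrow> real) \<Rightarrow> nat \<Rightarrow> (nat \<Rightarrow> 'a) \<Rightarrow> real" where
  "kernel_det K k x = (\<Sum>p | p permutes {..<k}. of_int (sign p) * (\<Prod>i<k. K (x i) (x (p i))))"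

definition pcount :: "('b \<Rightarrow> 'a set) \<Rightarrow> 'a set \<Rightarrow> 'b \<Rightarrow> nat" where
  "pcount X A \<omega> = card (X \<omega> \<inter> A)"

definition point_process :: "'b measure \<Rightarrow> ('b \<Rightarrow> 'a::euclidean_space set) \<Rightarrow> bool" where
  "point_process M X \<longleftrightarrow> prob_space M \<and>
     (\<forall>\<omega>\<in>space M. \<forall>A. bounded A \<longrightarrow> finite (X \<omega> \<inter> A)) \<and>
     (\<forall>A\<in>sets borel. pcount X A \<in> measurable M (count_space UNIV))"

definition has_correlation_functions ::
  "'b measure \<Rightarrow> ('b \<Rightarrow> 'a::euclidean_space set) \<Rightarrow> (nat \<Rightarrow> (nat \<Rightarrow> 'a) \<Rightarrow> real) \<Rightarrow> bool" where
  "has_correlation_functions M X \<rho> \<longleftrightarrow>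
     (\<forall>k A. k \<ge> 1 \<longrightarrow> (\<forall>i<k. A i \<in> sets borel \<and> bounded (A i)) \<longrightarrow>
        (\<forall>i<k. \<forall>j<k. i \<noteq> j \<longrightarrow> A i \<inter> A j = {}) \<longrightarrow>
        (\<integral>\<^sup>+ \<omega>. (\<Prod>i<k. ennreal (real (pcount X (A i) \<omega>))) \<partial>M) =
        (\<integral>\<^sup>+ x. ennreal ((\<Prod>i<k. indicator (A i) (x i)) * \<rho> k x)
            \<partial>(PiM {..<k} (\<lambda>_. lborel))))"

definition is_DPP :: "'b measure \<Rightarrow> ('b \<Rightarrow> 'a::euclidean_space set) \<Rightarrow> ('a \<Rightarrow> 'a \<Rightarrow> real) \<Rightarrow> bool" where
  "is_DPP M X K \<longleftrightarrow> point_process M X \<and> has_correlation_functions M X (kernel_det K)"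

end

theory Submission
  imports Defs
begin

text \<open>
  Write \<open>N\<close> for the number of points in the ball \<open>B\<close>, and \<open>n = |B|\<close>. It suffices to show
  \<open>E (1 + z)^N \<le> exp (z n)\<close> for all \<open>z > -1\<close>, the Laplace bound satisfied by a Poisson variable;
  Bernstein's inequality then follows by Chernoff's method.

  Cut \<open>B\<close> into small cells of volume \<open>a\<^sub>i\<close> containing \<open>N\<^sub>i\<close> points. Expanding the product
  \<open>\<Prod>(1 + z N\<^sub>i)\<close> over sets of distinct cells and inserting the correlation functions gives the exact
  identity \<open>E \<Prod>(1 + z N\<^sub>i) = E det (I + z L(x))\<close>, where \<open>L(x)\<^sub>i\<^sub>j = sqrt (a\<^sub>i a\<^sub>j) K(x\<^sub>i, x\<^sub>j)\<close>
  and the \<open>x\<^sub>i\<close> are independent and uniform in their cells. The matrix \<open>I + z L(x)\<close> is positive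
  semidefinite: for \<open>z \<ge> 0\<close> because \<open>K\<close> is a positive kernel, and for \<open>-1 < z < 0\<close> and fine cells by the
  Schur test, because \<open>K(x, \<cdot>)\<close> has integral one. Hadamard's inequality bounds its determinant by
  \<open>\<Prod>(1 + z a\<^sub>i) \<le> exp (z n)\<close>. As the cells shrink, \<open>\<Prod>(1 + z N\<^sub>i)\<close> tends to \<open>(1 + z)^N\<close>; Fatou's lemma
  handles \<open>z \<ge> 0\<close>, and \<open>2^N\<close> is then an integrable majorant for \<open>z < 0\<close>.
\<close>

section \<open>Determinants of positive semidefinite matrices over finite index sets\<close>

text \<open>Indexed by sets rather than by a matrix type: principal minors \<open>det_on S A\<close>
  then use the same function \<open>A\<close>, and inductions can remove one index at a
  time.\<close>

definition det_on :: "'i set \<Rightarrow> ('i \<Rightarrow> 'i \<Rightarrow> real) \<Rightarrow> real" where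
  "det_on I A = (\<Sum>p | p permutes I. of_int (sign p) * (\<Prod>i\<in>I. A i (p i)))"

definition psd_on :: "'i set \<Rightarrow> ('i \<Rightarrow> 'i \<Rightarrow> real) \<Rightarrow> bool" where
  "psd_on I A \<longleftrightarrow> (\<forall>i\<in>I. \<forall>j\<in>I. A i j = A j i) \<and>
     (\<forall>c. 0 \<le> (\<Sum>i\<in>I. \<Sum>j\<in>I. c i * c j * A i j))"

lemma det_on_empty [simp]: "det_on {} A = 1"
  by (simp add: det_on_def)

lemma det_on_cong:
  assumes "\<And>i j. i \<in> I \<Longrightarrow> j \<in> I \<Longrightarrow> A i j = B i j"
  shows "det_on I A = det_on I B"
  unfolding det_on_def
  by (intro sum.cong refl arg_cong2[where f = "(*)"] prod.cong)
     (auto intro!: assms simp: permutes_in_image)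

text \<open>Composing each permutation with the transposition of \<open>i\<close> and
  \<open>j\<close> flips its sign but keeps its product, since the two rows agree. The determinant
  is therefore its own negative.\<close>

lemma det_on_eq_rows:
  assumes "finite I" "i \<in> I" "j \<in> I" "i \<noteq> j" and rows: "\<And>k. k \<in> I \<Longrightarrow> A i k = A j k"
  shows "det_on I A = 0"
proof -
  define \<tau> where "\<tau> = Transposition.transpose i j"
  have \<tau>: "\<tau> permutes I"
    unfolding \<tau>_def using assms(2,3) by (rule permutes_swap_id)
  have inv: "\<tau> (\<tau> l) = l" for l
    by (simp add: \<tau>_def)
  have "det_on I A = (\<Sum>p | p permutes I. of_int (sign (p \<circ> \<tau>)) * (\<Prod>l\<in>I. A l ((p \<circ> \<tau>) l)))"
    unfolding det_on_def by (rule sum_permutations_compose_right[OF \<tau>])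
  also have "\<dots> = (\<Sum>p | p permutes I. - (of_int (sign p) * (\<Prod>l\<in>I. A l (p l))))"
  proof (rule sum.cong[OF refl])
    fix p assume "p \<in> {p. p permutes I}"
    then have p: "p permutes I" by simp
    have "sign (p \<circ> \<tau>) = sign p * sign \<tau>"
      using p \<tau> assms(1) by (intro sign_compose) (auto simp: permutation_permutes)
    also have "sign \<tau> = -1"
      unfolding \<tau>_def using assms(4) by (simp add: sign_swap_id)
    finally have sg: "sign (p \<circ> \<tau>) = - sign p" by (simp only: mult_minus_right mult_1_right)
    have "(\<Prod>l\<in>I. A l ((p \<circ> \<tau>) l)) = (\<Prod>l\<in>I. A (\<tau> l) (p l))"
      by (subst prod.permute[OF \<tau>]) (simp add: o_def inv)
    also have "\<dots> = (\<Prod>l\<in>I. A l (p l))"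
      using rows permutes_in_image[OF p]
      by (intro prod.cong refl) (auto simp: \<tau>_def Transposition.transpose_def)
    finally show "of_int (sign (p \<circ> \<tau>)) * (\<Prod>l\<in>I. A l ((p \<circ> \<tau>) l)) =
        - (of_int (sign p) * (\<Prod>l\<in>I. A l (p l)))"
      using sg by simp
  qed
  also have "\<dots> = - det_on I A"
    by (simp add: det_on_def sum_negf)
  finally show ?thesis by simp
qed

text \<open>By linearity in row \<open>i\<close>; the correction term is a determinant in which row
  \<open>t\<close> occurs twice.\<close>

lemma det_on_row_op:
  assumes "finite I" "i \<in> I" "t \<in> I" "i \<noteq> t"
  shows "det_on I (A(i := \<lambda>k. A i k - c * A t k)) = det_on I A"
proof -
  have split: "(\<Prod>l\<in>I. (A(i := r)) l (p l)) = r (p i) * (\<Prod>l\<in>I-{i}. A l (p l))" for r p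
    by (subst prod.remove[OF assms(1,2)]) (auto intro!: prod.cong)
  have "det_on I (A(i := \<lambda>k. A i k - c * A t k)) =
      det_on I (A(i := A i)) - c * det_on I (A(i := A t))"
    unfolding det_on_def split sum_distrib_left sum_subtractf[symmetric]
    by (intro sum.cong refl) (simp add: algebra_simps)
  also have "det_on I (A(i := A t)) = 0"
    using assms by (intro det_on_eq_rows[of I i t]) auto
  finally show ?thesis by (simp only: fun_upd_triv mult_zero_right diff_zero)
qed

text \<open>The pivot row \<open>t\<close> is outside \<open>U\<close> and is never altered, so the
  single row operations can be performed one after the other.\<close>

lemma det_on_row_ops:
  assumes "finite I" "t \<in> I" "U \<subseteq> I - {t}"
  shows "det_on I (\<lambda>i k. if i \<in> U then A i k - c i * A t k else A i k) = det_on I A"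
proof -
  have "finite U" using assms finite_subset by blast
  then show ?thesis using assms(3)
  proof (induction U)
    case (insert u U)
    let ?B = "\<lambda>i k. if i \<in> U then A i k - c i * A t k else A i k"
    have "(\<lambda>i k. if i \<in> insert u U then A i k - c i * A t k else A i k) =
        ?B(u := \<lambda>k. ?B u k - c u * ?B t k)"
      using insert by (auto simp: fun_eq_iff)
    moreover have "det_on I (?B(u := \<lambda>k. ?B u k - c u * ?B t k)) = det_on I ?B"
      using insert assms by (intro det_on_row_op) auto
    ultimately show ?case using insert by simp
  qed simp
qed

text \<open>A permutation that moves \<open>t\<close> sends some \<open>i\<close> in
  \<open>T\<close> to \<open>t\<close> and so picks up a vanishing factor. The survivors fix
  \<open>t\<close>, hence permute \<open>T\<close>.\<close>

lemma det_on_insert_zero_column: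
  assumes "finite T" "t \<notin> T" "\<And>i. i \<in> T \<Longrightarrow> A i t = 0"
  shows "det_on (insert t T) A = A t t * det_on T A"
proof -
  have "det_on (insert t T) A =
      (\<Sum>p | p permutes T. of_int (sign p) * (\<Prod>i\<in>insert t T. A i (p i)))"
    unfolding det_on_def
  proof (rule sum.mono_neutral_right)
    show "finite {p. p permutes insert t T}" using assms by (simp add: finite_permutations)
    show "{p. p permutes T} \<subseteq> {p. p permutes insert t T}"
      by (auto intro: permutes_subset)
    show "\<forall>p\<in>{p. p permutes insert t T} - {p. p permutes T}.
        of_int (sign p) * (\<Prod>i\<in>insert t T. A i (p i)) = 0"
    proof
      fix p assume "p \<in> {p. p permutes insert t T} - {p. p permutes T}"
      then have p: "p permutes insert t T" "\<not> p permutes T" by auto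
      have "p t \<noteq> t"
        using p permutes_superset[OF p(1), of T] by auto
      moreover obtain i where i: "p i = t" "i \<in> insert t T"
        using p(1) by (metis insertI1 permutes_def)
      ultimately have "i \<in> T" by auto
      then have "A i (p i) = 0" using assms(3) i by simp
      then show "of_int (sign p) * (\<Prod>i\<in>insert t T. A i (p i)) = 0"
        using \<open>i \<in> T\<close> assms(1) by (auto intro!: prod_zero)
    qed
  qed
  also have "\<dots> = A t t * det_on T A"
    unfolding det_on_def sum_distrib_left
    using assms(1,2) by (intro sum.cong refl) (simp add: permutes_not_in)
  finally show ?thesis .
qed

text \<open>Gaussian elimination with pivot \<open>A t t\<close> clears the rest of column
  \<open>t\<close>; what remains on \<open>T\<close> is the Schur complement of the pivot.\<close>

lemma det_on_schur_complement:
  assumes "finite T" "t \<notin> T" "A t t \<noteq> 0"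
  shows "det_on (insert t T) A = A t t * det_on T (\<lambda>i j. A i j - A i t / A t t * A t j)"
proof -
  let ?B = "\<lambda>i k. if i \<in> T then A i k - A i t / A t t * A t k else A i k"
  have "det_on (insert t T) A = det_on (insert t T) ?B"
    using assms by (intro det_on_row_ops[symmetric]) auto
  also have "\<dots> = ?B t t * det_on T ?B"
    using assms by (intro det_on_insert_zero_column) auto
  also have "det_on T ?B = det_on T (\<lambda>i j. A i j - A i t / A t t * A t j)"
    by (rule det_on_cong) simp
  finally show ?thesis using assms(2) by simp
qed

lemma psd_on_subset:
  assumes "psd_on I A" "J \<subseteq> I" "finite I"
  shows "psd_on J A"
  unfolding psd_on_def
proof (intro conjI allI)
  show "\<forall>i\<in>J. \<forall>j\<in>J. A i j = A j i"
    using assms by (auto simp: psd_on_def)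
  fix c :: "'a \<Rightarrow> real"
  \<comment> \<open>Extension by zero, which leaves the quadratic form unchanged.\<close>
  define d where "d i = (if i \<in> J then c i else 0)" for i
  have "(\<Sum>i\<in>I. \<Sum>j\<in>I. d i * d j * A i j) = (\<Sum>i\<in>J. \<Sum>j\<in>I. d i * d j * A i j)"
    using assms by (intro sum.mono_neutral_right) (auto simp: d_def)
  also have "\<dots> = (\<Sum>i\<in>J. \<Sum>j\<in>J. d i * d j * A i j)"
    using assms by (intro sum.cong refl sum.mono_neutral_right) (auto simp: d_def)
  also have "\<dots> = (\<Sum>i\<in>J. \<Sum>j\<in>J. c i * c j * A i j)"
    by (intro sum.cong refl) (auto simp: d_def)
  finally have "(\<Sum>i\<in>I. \<Sum>j\<in>I. d i * d j * A i j) = (\<Sum>i\<in>J. \<Sum>j\<in>J. c i * c j * A i j)" .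
  moreover have "0 \<le> (\<Sum>i\<in>I. \<Sum>j\<in>I. d i * d j * A i j)"
    using assms(1) unfolding psd_on_def by blast
  ultimately show "0 \<le> (\<Sum>i\<in>J. \<Sum>j\<in>J. c i * c j * A i j)" by simp
qed

lemma psd_on_diag_nonneg:
  assumes "psd_on I A" "i \<in> I" "finite I"
  shows "0 \<le> A i i"
proof -
  have "psd_on {i} A" using psd_on_subset[OF assms(1)] assms by auto
  then have "\<forall>c. 0 \<le> (\<Sum>k\<in>{i}. \<Sum>l\<in>{i}. c k * c l * A k l)"
    unfolding psd_on_def by blast
  from spec[OF this, of "\<lambda>_. 1"] show ?thesis by simp
qed

text \<open>With \<open>A t t = 0\<close> the form on the coordinates \<open>i\<close> and
  \<open>t\<close> is affine in \<open>c t\<close> with slope \<open>2 * c i * A i t\<close>; a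
  nonzero slope would make it negative somewhere.\<close>

lemma psd_on_zero_diag:
  assumes "psd_on I A" "i \<in> I" "t \<in> I" "finite I" "A t t = 0"
  shows "A i t = 0" "A t i = 0"
proof -
  show "A i t = 0"
  proof (cases "i = t")
    case False
    have "psd_on {i, t} A" using psd_on_subset[OF assms(1)] assms by auto
    then have "0 \<le> (\<Sum>k\<in>{i,t}. \<Sum>l\<in>{i,t}. c k * c l * A k l)" for c
      unfolding psd_on_def by blast
    moreover have "A t i = A i t"
      using assms(1-3) unfolding psd_on_def by blast
    ultimately have q: "0 \<le> c i * c i * A i i + 2 * c i * c t * A i t" for c
      using False assms(5) by (force simp: algebra_simps)
    show ?thesis
    proof (rule ccontr)
      assume "A i t \<noteq> 0"
      then show False
        \<comment> \<open>This choice gives the form the value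
          \<open>A i i - (A i i + 1) = -1\<close>.\<close>
        using q[of "\<lambda>k. if k = i then 1 else - (A i i + 1) / (2 * A i t)"] False
        by (simp add: field_simps)
    qed
  qed (use assms in simp)
  then show "A t i = 0" using assms unfolding psd_on_def by metis
qed

text \<open>Completing the square: the form of the Schur complement at \<open>c\<close> is the
  minimum of the form of \<open>A\<close> over all extensions of \<open>c\<close> to the coordinate
  \<open>t\<close>.\<close>

lemma psd_on_schur_complement:
  assumes "psd_on (insert t T) A" "finite T" "t \<notin> T" "A t t > 0"
  shows "psd_on T (\<lambda>i j. A i j - A i t / A t t * A t j)"
  unfolding psd_on_def
proof (intro conjI allI)
  have sym: "A i j = A j i" if "i \<in> insert t T" "j \<in> insert t T" for i j
    using assms(1) that unfolding psd_on_def by blast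
  show "\<forall>i\<in>T. \<forall>j\<in>T. A i j - A i t / A t t * A t j = A j i - A j t / A t t * A t i"
    using sym by simp
  fix c :: "'a \<Rightarrow> real"
  define s where "s = (\<Sum>i\<in>T. c i * A i t)"
  \<comment> \<open>The value at \<open>t\<close> is the minimizer of
    \<open>y * y * A t t + 2 * y * s\<close> over \<open>y\<close>.\<close>
  define d where "d i = (if i = t then - s / A t t else c i)" for i
  have d: "d i = c i" if "i \<in> T" for i using that assms(3) by (auto simp: d_def)
  have s': "(\<Sum>j\<in>T. c j * A t j) = s"
    unfolding s_def using sym by (intro sum.cong) auto
  have "0 \<le> (\<Sum>i\<in>insert t T. \<Sum>j\<in>insert t T. d i * d j * A i j)"
    using assms(1) by (auto simp: psd_on_def)
  also have "\<dots> = d t * d t * A t t + (\<Sum>j\<in>T. d t * c j * A t j)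
      + ((\<Sum>i\<in>T. c i * d t * A i t) + (\<Sum>i\<in>T. \<Sum>j\<in>T. c i * c j * A i j))"
    using assms(2,3) by (simp add: d sum.distrib)
  also have "(\<Sum>j\<in>T. d t * c j * A t j) = d t * s"
    by (simp add: s'[symmetric] sum_distrib_left mult.assoc)
  also have "(\<Sum>i\<in>T. c i * d t * A i t) = d t * s"
    by (simp add: s_def sum_distrib_left mult_ac)
  also have "d t * d t * A t t + d t * s + (d t * s + (\<Sum>i\<in>T. \<Sum>j\<in>T. c i * c j * A i j))
      = (\<Sum>i\<in>T. \<Sum>j\<in>T. c i * c j * A i j) - s * s / A t t"
    using assms(4) by (simp add: d_def field_simps)
  also have "s * s / A t t = (\<Sum>i\<in>T. \<Sum>j\<in>T. c i * c j * (A i t / A t t * A t j))"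
  proof -
    have "s * s / A t t = (\<Sum>i\<in>T. c i * A i t) * (\<Sum>j\<in>T. c j * A t j) / A t t"
      unfolding s' by (simp add: s_def)
    also have "\<dots> = (\<Sum>i\<in>T. \<Sum>j\<in>T. c i * c j * (A i t / A t t * A t j))"
      unfolding sum_product sum_divide_distrib by (intro sum.cong refl) simp
    finally show ?thesis .
  qed
  also have "(\<Sum>i\<in>T. \<Sum>j\<in>T. c i * c j * A i j) - \<dots> =
      (\<Sum>i\<in>T. \<Sum>j\<in>T. c i * c j * (A i j - A i t / A t t * A t j))"
    by (simp add: sum_subtractf right_diff_distrib)
  finally show "0 \<le> (\<Sum>i\<in>T. \<Sum>j\<in>T. c i * c j * (A i j - A i t / A t t * A t j))" .
qed

text \<open>Induction by pivoting on \<open>t\<close>. The Schur complement is again positive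
  semidefinite, and its diagonal entries are those of \<open>A\<close> decreased by
  \<open>A i t * A i t / A t t\<close>. A zero pivot forces column \<open>t\<close> to vanish, and
  then the determinant and the diagonal product are both zero.\<close>

theorem hadamard_psd_on:
  assumes "finite I" "psd_on I A"
  shows "0 \<le> det_on I A \<and> det_on I A \<le> (\<Prod>i\<in>I. A i i)"
  using assms
proof (induction I arbitrary: A)
  case (insert t T)
  have diag: "0 \<le> A i i" if "i \<in> insert t T" for i
    using psd_on_diag_nonneg[OF insert.prems that] insert.hyps by simp
  show ?case
  proof (cases "A t t = 0")
    case True
    have z: "A i t = 0" if "i \<in> insert t T" for i
      using psd_on_zero_diag[OF insert.prems that _ _ True] insert.hyps by simp
    have "det_on (insert t T) A = A t t * det_on T A"
      using insert.hyps z by (intro det_on_insert_zero_column) auto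
    then show ?thesis using True insert.hyps by simp
  next
    case False
    with diag[of t] have pos: "A t t > 0" by simp
    let ?B = "\<lambda>i j. A i j - A i t / A t t * A t j"
    have psd: "psd_on T ?B"
      using insert pos by (intro psd_on_schur_complement) auto
    have "det_on T ?B \<le> (\<Prod>i\<in>T. ?B i i)"
      using insert.IH[OF psd] by simp
    also have "\<dots> \<le> (\<Prod>i\<in>T. A i i)"
    proof (rule prod_mono, intro conjI)
      fix i assume i: "i \<in> T"
      show "0 \<le> ?B i i" using psd_on_diag_nonneg[OF psd i] insert.hyps by simp
      have "A i t = A t i" using insert.prems i unfolding psd_on_def by blast
      then show "?B i i \<le> A i i" using pos by simp
    qed
    finally have "A t t * det_on T ?B \<le> A t t * (\<Prod>i\<in>T. A i i)"
      using pos by (intro mult_left_mono) auto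
    moreover have "0 \<le> A t t * det_on T ?B"
      using insert.IH[OF psd] pos by auto
    ultimately show ?thesis
      unfolding det_on_schur_complement[of T t A, OF insert.hyps False] prod.insert[OF insert.hyps] by blast
  qed
qed simp

text \<open>Cholesky factorization: row \<open>t\<close> of the factor is the pivot row over
  \<open>sqrt (A t t)\<close>, and the other rows factor the Schur complement and vanish at
  \<open>t\<close>.\<close>

lemma psd_on_gram:
  assumes "finite I" "psd_on I A"
  shows "\<exists>P. \<forall>i\<in>I. \<forall>j\<in>I. A i j = (\<Sum>b\<in>I. P b i * P b j)"
  using assms
proof (induction I arbitrary: A)
  case (insert t T)
  have tt: "0 \<le> A t t"
    using psd_on_diag_nonneg[OF insert.prems] insert.hyps by simp
  have sym: "A i j = A j i" if "i \<in> insert t T" "j \<in> insert t T" for i j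
    using insert.prems that unfolding psd_on_def by blast
  \<comment> \<open>Division by zero yields 0, so for a zero pivot the complement is just
    \<open>A\<close> on \<open>T\<close>.\<close>
  have "psd_on T (\<lambda>i j. A i j - A i t / A t t * A t j)"
  proof (cases "A t t = 0")
    case True
    then show ?thesis using psd_on_subset[OF insert.prems, of T] insert.hyps by auto
  next
    case False
    with tt insert show ?thesis by (intro psd_on_schur_complement) auto
  qed
  from insert.IH[OF this] obtain P where
    P: "A i j - A i t / A t t * A t j = (\<Sum>b\<in>T. P b i * P b j)" if "i \<in> T" "j \<in> T" for i j
    by auto
  define Q where "Q b i = (if b = t then A t i / sqrt (A t t) else if i = t then 0 else P b i)" for b i
  have z: "A t i = 0" if "A t t = 0" "i \<in> insert t T" for i
    using psd_on_zero_diag(2)[OF insert.prems that(2) _ _ that(1)] insert.hyps by simp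
  have "A i j = (\<Sum>b\<in>insert t T. Q b i * Q b j)" if ij: "i \<in> insert t T" "j \<in> insert t T" for i j
  proof -
    have "(\<Sum>b\<in>insert t T. Q b i * Q b j) = Q t i * Q t j + (\<Sum>b\<in>T. Q b i * Q b j)"
      using insert.hyps by simp
    also have "Q t i * Q t j = A i t / A t t * A t j"
      using tt sym[OF ij(1), of t] by (simp add: Q_def)
    also have "(\<Sum>b\<in>T. Q b i * Q b j) = (if i = t \<or> j = t then 0 else \<Sum>b\<in>T. P b i * P b j)"
      using insert.hyps by (auto simp: Q_def intro!: sum.cong sum.neutral)
    also have "\<dots> = (if i = t \<or> j = t then 0 else A i j - A i t / A t t * A t j)"
      using P[of i j] ij by auto
    finally show ?thesis
      using z[OF _ ij(1)] z[OF _ ij(2)] sym[OF ij(1), of t] by (cases "A t t = 0") auto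
  qed
  then show ?case by blast
qed simp

text \<open>Expanding the product for each permutation lets every row choose \<open>A\<close> (the
  set \<open>S\<close>) or the identity. The identity rows kill all permutations that do not fix
  \<open>I - S\<close>, which leaves the permutations of \<open>S\<close> and hence the principal
  minors.\<close>

lemma det_on_one_plus:
  assumes "finite I"
  shows "det_on I (\<lambda>i j. A i j + (if i = j then 1 else 0)) = (\<Sum>S\<in>Pow I. det_on S A)"
proof -
  let ?d = "\<lambda>i j. if i = j then 1 else (0::real)"
  have "det_on I (\<lambda>i j. A i j + ?d i j) =
      (\<Sum>p | p permutes I. \<Sum>S\<in>Pow I. of_int (sign p) * ((\<Prod>i\<in>S. A i (p i)) * (\<Prod>i\<in>I-S. ?d i (p i))))"
    unfolding det_on_def
    unfolding prod_add[OF assms] sum_distrib_left by (rule refl)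
  also have "\<dots> = (\<Sum>S\<in>Pow I. \<Sum>p | p permutes I. of_int (sign p) * ((\<Prod>i\<in>S. A i (p i)) * (\<Prod>i\<in>I-S. ?d i (p i))))"
    by (rule sum.swap)
  also have "\<dots> = (\<Sum>S\<in>Pow I. det_on S A)"
  proof (rule sum.cong[OF refl])
    fix S assume S: "S \<in> Pow I"
    have "(\<Sum>p | p permutes I. of_int (sign p) * ((\<Prod>i\<in>S. A i (p i)) * (\<Prod>i\<in>I-S. ?d i (p i)))) =
       (\<Sum>p | p permutes S. of_int (sign p) * ((\<Prod>i\<in>S. A i (p i)) * (\<Prod>i\<in>I-S. ?d i (p i))))"
    proof (rule sum.mono_neutral_right)
      show "finite {p. p permutes I}" using assms by (simp add: finite_permutations)
      show "{p. p permutes S} \<subseteq> {p. p permutes I}"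
        using S by (auto intro: permutes_subset)
      show "\<forall>p\<in>{p. p permutes I} - {p. p permutes S}.
          of_int (sign p) * ((\<Prod>i\<in>S. A i (p i)) * (\<Prod>i\<in>I-S. ?d i (p i))) = 0"
      proof
        fix p assume p: "p \<in> {p. p permutes I} - {p. p permutes S}"
        then obtain i where "i \<in> I - S" "p i \<noteq> i"
          using permutes_superset[of p I S] by auto
        then have "(\<Prod>i\<in>I-S. ?d i (p i)) = 0"
          using assms by (intro prod_zero) (auto intro!: bexI[of _ i])
        then show "of_int (sign p) * ((\<Prod>i\<in>S. A i (p i)) * (\<Prod>i\<in>I-S. ?d i (p i))) = 0"
          by simp
      qed
    qed
    also have "\<dots> = det_on S A"
      unfolding det_on_def by (intro sum.cong refl) (simp add: permutes_not_in)
    finally show "(\<Sum>p | p permutes I. of_int (sign p) * ((\<Prod>i\<in>S. A i (p i)) * (\<Prod>i\<in>I-S. ?d i (p i)))) = det_on S A" .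
  qed
  finally show ?thesis .
qed

lemma det_on_scale:
  "det_on I (\<lambda>i j. u i * v j * A i j) = (\<Prod>i\<in>I. u i * v i) * det_on I A"
  unfolding det_on_def sum_distrib_left
proof (rule sum.cong[OF refl])
  fix p assume "p \<in> {p. p permutes I}"
  then have p: "p permutes I" by simp
  have "(\<Prod>i\<in>I. v (p i)) = (\<Prod>i\<in>I. v i)"
    using prod.permute[OF p, of v] by (simp add: o_def)
  then show "of_int (sign p) * (\<Prod>i\<in>I. u i * v (p i) * A i (p i)) =
      (\<Prod>i\<in>I. u i * v i) * (of_int (sign p) * (\<Prod>i\<in>I. A i (p i)))"
    by (simp add: prod.distrib)
qed

text \<open>Conjugation by \<open>f\<close>, written \<open>map_permutation J f\<close>, is a
  sign-preserving bijection between the permutations of \<open>J\<close> and those of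
  \<open>I\<close>.\<close>

lemma det_on_reindex:
  assumes f: "bij_betw f J I" and "finite I"
  shows "det_on I A = det_on J (\<lambda>i j. A (f i) (f j))"
proof -
  have fin: "finite J" and inj: "inj_on f J" and im: "f ` J = I"
    using assms bij_betw_finite by (auto simp: bij_betw_def)
  have "det_on J (\<lambda>i j. A (f i) (f j)) =
      (\<Sum>p | p permutes J. of_int (sign (map_permutation J f p)) *
        (\<Prod>i\<in>I. A i (map_permutation J f p i)))"
    unfolding det_on_def
  proof (rule sum.cong[OF refl])
    fix p assume "p \<in> {p. p permutes J}"
    then have p: "p permutes J" by simp
    have "(\<Prod>i\<in>I. A i (map_permutation J f p i)) = (\<Prod>i\<in>J. A (f i) (f (p i)))"
      unfolding im[symmetric] using inj
      by (subst prod.reindex) (auto simp: map_permutation_apply intro!: prod.cong)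
    then show "of_int (sign p) * (\<Prod>i\<in>J. A (f i) (f (p i))) =
        of_int (sign (map_permutation J f p)) * (\<Prod>i\<in>I. A i (map_permutation J f p i))"
      using sign_map_permutation[OF inj p fin] by simp
  qed
  also have "\<dots> = det_on I A"
  proof -
    have "map_permutation J f = (\<lambda>p x. if x \<in> I then f (p (inv_into J f x)) else x)"
      by (auto simp: map_permutation_def restrict_id_def fun_eq_iff im)
    then have "bij_betw (map_permutation J f) {p. p permutes J} {p. p permutes I}"
      using bij_betw_permutations[OF f] by simp
    then show ?thesis
      unfolding det_on_def by (rule sum.reindex_bij_betw)
  qed
  finally show ?thesis by simp
qed

lemma psd_on_scale:
  assumes "psd_on I A"
  shows "psd_on I (\<lambda>i j. v i * v j * A i j)"
  unfolding psd_on_def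
proof (intro conjI allI ballI)
  fix i j assume "i \<in> I" "j \<in> I"
  then have "A i j = A j i" using assms unfolding psd_on_def by blast
  then show "v i * v j * A i j = v j * v i * A j i" by simp
next
  fix c :: "'a \<Rightarrow> real"
  have "\<forall>c. 0 \<le> (\<Sum>i\<in>I. \<Sum>j\<in>I. c i * c j * A i j)"
    using assms unfolding psd_on_def by blast
  from spec[OF this, of "\<lambda>i. c i * v i"]
  show "0 \<le> (\<Sum>i\<in>I. \<Sum>j\<in>I. c i * c j * (v i * v j * A i j))"
    by (simp add: mult_ac)
qed

section \<open>The Gaussian kernel\<close>

text \<open>A case of the Schur product theorem: expanding the inner product over
  \<open>Basis\<close> gives a sum of rank-one rescalings of \<open>A\<close>, each positive
  semidefinite.\<close>

lemma psd_on_inner_mult: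
  fixes u :: "'i \<Rightarrow> 'a::euclidean_space"
  assumes "psd_on I A"
  shows "psd_on I (\<lambda>i j. (u i \<bullet> u j) * A i j)"
  unfolding psd_on_def
proof (intro conjI allI ballI)
  fix i j assume "i \<in> I" "j \<in> I"
  then have "A i j = A j i" using assms unfolding psd_on_def by blast
  then show "(u i \<bullet> u j) * A i j = (u j \<bullet> u i) * A j i" by (simp add: inner_commute)
next
  fix c :: "'i \<Rightarrow> real"
  have "(\<Sum>i\<in>I. \<Sum>j\<in>I. c i * c j * ((u i \<bullet> u j) * A i j)) =
      (\<Sum>i\<in>I. \<Sum>j\<in>I. \<Sum>b\<in>Basis. c i * c j * ((u i \<bullet> b) * (u j \<bullet> b) * A i j))"
    by (subst euclidean_inner) (simp add: sum_distrib_left sum_distrib_right)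
  also have "\<dots> = (\<Sum>i\<in>I. \<Sum>b\<in>Basis. \<Sum>j\<in>I. c i * c j * ((u i \<bullet> b) * (u j \<bullet> b) * A i j))"
    by (intro sum.cong refl sum.swap)
  also have "\<dots> = (\<Sum>b\<in>Basis. \<Sum>i\<in>I. \<Sum>j\<in>I. c i * c j * ((u i \<bullet> b) * (u j \<bullet> b) * A i j))"
    by (rule sum.swap)
  also have "\<dots> \<ge> 0"
  proof (rule sum_nonneg)
    fix b :: 'a
    show "0 \<le> (\<Sum>i\<in>I. \<Sum>j\<in>I. c i * c j * ((u i \<bullet> b) * (u j \<bullet> b) * A i j))"
      using psd_on_scale[OF assms, of "\<lambda>i. u i \<bullet> b"] unfolding psd_on_def by blast
  qed
  finally show "0 \<le> (\<Sum>i\<in>I. \<Sum>j\<in>I. c i * c j * ((u i \<bullet> u j) * A i j))" .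
qed

lemma psd_on_inner_power:
  fixes u :: "'i \<Rightarrow> 'a::euclidean_space"
  shows "psd_on I (\<lambda>i j. (u i \<bullet> u j) ^ n)"
proof (induction n)
  case 0
  have "(\<Sum>i\<in>I. \<Sum>j\<in>I. c i * c j) = (\<Sum>i\<in>I. c i) * (\<Sum>i\<in>I. c i)" for c :: "'i \<Rightarrow> real"
    by (simp add: sum_product)
  then show ?case by (simp add: psd_on_def)
next
  case (Suc n)
  then show ?case using psd_on_inner_mult[OF Suc, of u] by simp
qed

text \<open>The exponential series has nonnegative coefficients, and every entrywise power of a Gram
  matrix is positive semidefinite; the quadratic form is the sum of a series of nonnegative
  terms.\<close>

lemma psd_on_exp_inner:
  fixes u :: "'i \<Rightarrow> 'a::euclidean_space"
  shows "psd_on I (\<lambda>i j. exp (u i \<bullet> u j))"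
  unfolding psd_on_def
proof (intro conjI allI ballI)
  fix i j show "exp (u i \<bullet> u j) = exp (u j \<bullet> u i)" by (simp add: inner_commute)
next
  fix c :: "'i \<Rightarrow> real"
  have sums: "(\<lambda>n. \<Sum>i\<in>I. \<Sum>j\<in>I. c i * c j * ((u i \<bullet> u j) ^ n /\<^sub>R fact n)) sums
      (\<Sum>i\<in>I. \<Sum>j\<in>I. c i * c j * exp (u i \<bullet> u j))"
    by (intro sums_sum sums_mult exp_converges)
  have nonneg: "0 \<le> (\<Sum>i\<in>I. \<Sum>j\<in>I. c i * c j * ((u i \<bullet> u j) ^ n /\<^sub>R fact n))" for n
  proof -
    have "(\<Sum>i\<in>I. \<Sum>j\<in>I. c i * c j * ((u i \<bullet> u j) ^ n /\<^sub>R fact n)) =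
        (\<Sum>i\<in>I. \<Sum>j\<in>I. c i * c j * (u i \<bullet> u j) ^ n) /\<^sub>R fact n"
      by (simp add: sum_distrib_left mult_ac)
    moreover have "0 \<le> (\<Sum>i\<in>I. \<Sum>j\<in>I. c i * c j * (u i \<bullet> u j) ^ n)"
      using psd_on_inner_power[of I u n] unfolding psd_on_def by blast
    ultimately show ?thesis by simp
  qed
  show "0 \<le> (\<Sum>i\<in>I. \<Sum>j\<in>I. c i * c j * exp (u i \<bullet> u j))"
    using nonneg by (rule sums_le[OF _ sums_zero sums])
qed

text \<open>Expanding the squared norm splits the Gaussian into a factor of \<open>u i\<close>, the
  same factor of \<open>u j\<close>, and \<open>exp (u i \<bullet> u j)\<close>; the first two only
  rescale.\<close>

lemma psd_on_gaussian:
  fixes u :: "'i \<Rightarrow> 'a::euclidean_space"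
  shows "psd_on I (\<lambda>i j. exp (- (1/2) * (norm (u i - u j))\<^sup>2))"
proof -
  have "exp (- (1/2) * (norm (u i - u j))\<^sup>2) =
      exp (- (1/2) * (u i \<bullet> u i)) * exp (- (1/2) * (u j \<bullet> u j)) * exp (u i \<bullet> u j)" for i j
    by (simp add: power2_norm_eq_inner inner_diff_left inner_diff_right inner_commute
        exp_add[symmetric] algebra_simps)
  then show ?thesis
    using psd_on_scale[OF psd_on_exp_inner[of I u], of "\<lambda>i. exp (- (1/2) * (u i \<bullet> u i))"] by simp
qed

section \<open>Gaussian integrals\<close>

lemma nn_integral_gaussian_1d:
  fixes a m :: real
  assumes "a > 0"
  shows "(\<integral>\<^sup>+ y. ennreal (exp (- (1/2) * (a * (y + m)\<^sup>2))) \<partial>lborel) = ennreal (sqrt (2 * pi) / sqrt a)"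
proof -
  let ?c = "sqrt (2 * pi) / sqrt a"
  have "exp (- (1/2) * (a * (y + m)\<^sup>2)) = ?c * normal_density (-m) (1 / sqrt a) y" for y
    using assms by (simp add: normal_density_def power_divide real_sqrt_divide real_sqrt_mult field_simps)
  then have "(\<integral>\<^sup>+ y. ennreal (exp (- (1/2) * (a * (y + m)\<^sup>2))) \<partial>lborel) =
      (\<integral>\<^sup>+ y. ennreal ?c * ennreal (normal_density (-m) (1 / sqrt a) y) \<partial>lborel)"
    using assms by (intro nn_integral_cong) (simp only: ennreal_mult'' normal_density_nonneg)
  also have "\<dots> = ennreal ?c * (\<integral>\<^sup>+ y. ennreal (normal_density (-m) (1 / sqrt a) y) \<partial>lborel)"
    by (rule nn_integral_cmult) simp
  also have "(\<integral>\<^sup>+ y. ennreal (normal_density (-m) (1 / sqrt a) y) \<partial>lborel) = 1"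
    using assms by (subst nn_integral_eq_integral) auto
  finally show ?thesis by simp
qed

text \<open>Coordinates are integrated out one by one. Completing the square in coordinate
  \<open>t\<close> leaves the form of the Schur complement \<open>B\<close>, while the determinant
  splits as \<open>A t t * det_on T B\<close>, so the constants multiply up correctly.\<close>

lemma nn_integral_gaussian_PiM:
  assumes "finite I" "psd_on I A" "det_on I A \<noteq> 0"
  shows "(\<integral>\<^sup>+ x. ennreal (exp (- (1/2) * (\<Sum>i\<in>I. \<Sum>j\<in>I. x i * x j * A i j))) \<partial>PiM I (\<lambda>_. lborel)) =
    ennreal (sqrt (2 * pi) ^ card I / sqrt (det_on I A))"
  using assms
proof (induction I arbitrary: A)
  case empty
  show ?case by (simp add: PiM_empty nn_integral_count_space_finite)
next
  case (insert t T)
  interpret product_sigma_finite "\<lambda>_::'a. lborel::real measure"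
    by (intro product_sigma_finite.intro) (rule sigma_finite_lborel)
  have sym: "A i j = A j i" if "i \<in> insert t T" "j \<in> insert t T" for i j
    using insert.prems(1) that unfolding psd_on_def by blast
  \<comment> \<open>A zero pivot would make column \<open>t\<close> vanish and with it the
    determinant.\<close>
  have "A t t \<noteq> 0"
  proof
    assume 0: "A t t = 0"
    have "A i t = 0" if "i \<in> T" for i
      using psd_on_zero_diag(1)[OF insert.prems(1), of i t] that 0 insert.hyps by simp
    then show False
      using det_on_insert_zero_column[of T t A] insert.hyps 0 insert.prems(2) by simp
  qed
  moreover have "0 \<le> A t t"
    using psd_on_diag_nonneg[OF insert.prems(1)] insert.hyps by simp
  ultimately have pos: "A t t > 0" by simp
  define B where "B i j = A i j - A i t / A t t * A t j" for i j
  have psdB: "psd_on T B"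
    unfolding B_def using insert pos by (intro psd_on_schur_complement) auto
  have detB: "det_on (insert t T) A = A t t * det_on T B"
    unfolding B_def using insert.hyps pos by (intro det_on_schur_complement) auto
  have "det_on T B \<noteq> 0" using detB insert.prems(2) by auto
  note IH = insert.IH[OF psdB this]
  define s where "s x = (\<Sum>i\<in>T. x i * A i t)" for x :: "'a \<Rightarrow> real"
  have square: "(\<Sum>i\<in>insert t T. \<Sum>j\<in>insert t T. (x(t := y)) i * (x(t := y)) j * A i j) =
     (\<Sum>i\<in>T. \<Sum>j\<in>T. x i * x j * B i j) + A t t * (y + s x / A t t)\<^sup>2" for x y
  proof -
    have s': "(\<Sum>j\<in>T. x j * A t j) = s x"
      unfolding s_def using sym by (intro sum.cong) auto
    have 1: "(\<Sum>j\<in>T. (x(t := y)) t * (x(t := y)) j * A t j) = y * s x"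
      unfolding s'[symmetric] sum_distrib_left using insert.hyps by (intro sum.cong) auto
    have 2: "(\<Sum>i\<in>T. (x(t := y)) i * (x(t := y)) t * A i t) = y * s x"
      unfolding s_def sum_distrib_left using insert.hyps by (intro sum.cong) auto
    have 3: "(\<Sum>i\<in>T. \<Sum>j\<in>T. (x(t := y)) i * (x(t := y)) j * A i j) = (\<Sum>i\<in>T. \<Sum>j\<in>T. x i * x j * A i j)"
      using insert.hyps by (intro sum.cong refl) auto
    have "s x * s x / A t t = (\<Sum>i\<in>T. x i * A i t) * (\<Sum>j\<in>T. x j * A t j) / A t t"
      unfolding s' by (simp add: s_def)
    also have "\<dots> = (\<Sum>i\<in>T. \<Sum>j\<in>T. x i * x j * (A i t / A t t * A t j))"
      unfolding sum_product sum_divide_distrib by (intro sum.cong refl) simp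
    finally have 4: "(\<Sum>i\<in>T. \<Sum>j\<in>T. x i * x j * B i j) =
        (\<Sum>i\<in>T. \<Sum>j\<in>T. x i * x j * A i j) - s x * s x / A t t"
      by (simp add: B_def sum_subtractf right_diff_distrib)
    have "(\<Sum>i\<in>insert t T. \<Sum>j\<in>insert t T. (x(t := y)) i * (x(t := y)) j * A i j) =
      y * y * A t t + y * s x + (y * s x + (\<Sum>i\<in>T. \<Sum>j\<in>T. x i * x j * A i j))"
      unfolding sum.insert[OF insert.hyps] sum.distrib 1 2 3 by simp
    then show ?thesis
      unfolding 4 using pos by (simp add: field_simps power2_eq_square)
  qed
  have "(\<integral>\<^sup>+ x. ennreal (exp (- (1/2) * (\<Sum>i\<in>insert t T. \<Sum>j\<in>insert t T. x i * x j * A i j)))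
        \<partial>PiM (insert t T) (\<lambda>_. lborel)) =
     (\<integral>\<^sup>+ x. (\<integral>\<^sup>+ y. ennreal (exp (- (1/2) * (\<Sum>i\<in>insert t T. \<Sum>j\<in>insert t T.
        (x(t := y)) i * (x(t := y)) j * A i j))) \<partial>lborel) \<partial>PiM T (\<lambda>_. lborel))"
    using insert.hyps by (intro product_nn_integral_insert) auto
  also have "\<dots> = (\<integral>\<^sup>+ x. ennreal (exp (- (1/2) * (\<Sum>i\<in>T. \<Sum>j\<in>T. x i * x j * B i j))) *
       ennreal (sqrt (2 * pi) / sqrt (A t t)) \<partial>PiM T (\<lambda>_. lborel))"
  proof (rule nn_integral_cong)
    fix x :: "'a \<Rightarrow> real"
    have "(\<integral>\<^sup>+ y. ennreal (exp (- (1/2) * (\<Sum>i\<in>insert t T. \<Sum>j\<in>insert t T.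
        (x(t := y)) i * (x(t := y)) j * A i j))) \<partial>lborel) =
       (\<integral>\<^sup>+ y. ennreal (exp (- (1/2) * (\<Sum>i\<in>T. \<Sum>j\<in>T. x i * x j * B i j))) *
          ennreal (exp (- (1/2) * (A t t * (y + s x / A t t)\<^sup>2))) \<partial>lborel)"
      unfolding square by (intro nn_integral_cong)
        (simp add: ennreal_mult[symmetric] exp_add[symmetric] field_simps)
    also have "\<dots> = ennreal (exp (- (1/2) * (\<Sum>i\<in>T. \<Sum>j\<in>T. x i * x j * B i j))) *
        ennreal (sqrt (2 * pi) / sqrt (A t t))"
      by (subst nn_integral_cmult) (auto simp only: nn_integral_gaussian_1d[OF pos] measurable_lborel1, measurable)
    finally show "(\<integral>\<^sup>+ y. ennreal (exp (- (1/2) * (\<Sum>i\<in>insert t T. \<Sum>j\<in>insert t T.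
        (x(t := y)) i * (x(t := y)) j * A i j))) \<partial>lborel) = \<dots>" .
  qed
  also have "\<dots> = ennreal (sqrt (2 * pi) ^ card T / sqrt (det_on T B)) * ennreal (sqrt (2 * pi) / sqrt (A t t))"
    unfolding IH[symmetric] by (rule nn_integral_multc) measurable
  also have "\<dots> = ennreal (sqrt (2 * pi) ^ card (insert t T) / sqrt (det_on (insert t T) A))"
    using hadamard_psd_on[OF _ psdB] insert.hyps pos
    by (simp add: detB ennreal_mult[symmetric] real_sqrt_mult mult_ac)
  finally show ?case .
qed

section \<open>Positive definite matrices and their inverses\<close>

lemma matrix_inv_inverse:
  fixes S :: "real^'n^'n"
  assumes "invertible S"
  shows "S ** matrix_inv S = mat 1" "matrix_inv S ** S = mat 1"
  using someI_ex[OF assms[unfolded invertible_def]] by (auto simp: matrix_inv_def)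

lemma pos_def_matrix_invertible:
  fixes S :: "real^'n^'n"
  assumes "pos_def_matrix S"
  shows "invertible S"
proof -
  have "x = 0" if "S *v x = 0" for x
  proof (rule ccontr)
    assume "x \<noteq> 0"
    then have "x \<bullet> (S *v x) > 0" using assms by (simp add: pos_def_matrix_def)
    with that show False by simp
  qed
  then show ?thesis
    by (metis invertible_left_inverse matrix_left_invertible_ker)
qed

lemma det_eq_det_on:
  fixes S :: "real^'n^'n"
  shows "det S = det_on UNIV (\<lambda>i j. S $ i $ j)"
  by (simp add: det_def det_on_def)

lemma inner_matrix_vector:
  fixes S :: "real^'n^'n"
  shows "x \<bullet> (S *v y) = (\<Sum>i\<in>UNIV. \<Sum>j\<in>UNIV. x $ i * y $ j * S $ i $ j)"
  by (simp add: inner_vec_def matrix_vector_mult_def sum_distrib_left mult_ac)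

text \<open>At \<open>x = S *v y\<close> the form of the inverse takes the value of the form of
  \<open>S\<close> at \<open>y\<close>. The transposed inverse is also an inverse of the symmetric
  \<open>S\<close>, which gives symmetry.\<close>

lemma pos_def_matrix_psd_inv:
  fixes S :: "real^'n^'n"
  assumes "pos_def_matrix S"
  shows "psd_on UNIV (\<lambda>i j. matrix_inv S $ i $ j)"
proof -
  let ?A = "matrix_inv S"
  note inv = matrix_inv_inverse[OF pos_def_matrix_invertible[OF assms]]
  have tS: "transpose S = S" using assms by (simp add: pos_def_matrix_def)
  have "transpose ?A ** S = mat 1"
    using inv(1) by (metis matrix_transpose_mul tS transpose_mat)
  then have tA: "transpose ?A = ?A"
    by (metis inv(1) matrix_mul_assoc matrix_mul_lid matrix_mul_rid)
  have "0 \<le> x \<bullet> (?A *v x)" for x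
  proof -
    define y where "y = ?A *v x"
    have x: "x = S *v y" by (simp add: y_def matrix_vector_mul_assoc inv)
    have "x \<bullet> (?A *v x) = y \<bullet> (S *v y)"
      by (simp add: y_def[symmetric] x[symmetric] inner_commute)
    also have "0 \<le> \<dots>"
      using assms by (cases "y = 0") (auto simp: pos_def_matrix_def less_imp_le)
    finally show ?thesis .
  qed
  then have "0 \<le> (\<Sum>i\<in>UNIV. \<Sum>j\<in>UNIV. c i * c j * ?A $ i $ j)" for c
    using inner_matrix_vector[of "\<chi> i. c i" ?A "\<chi> i. c i"] by (metis (no_types, lifting) sum.cong vec_lambda_beta)
  moreover have "?A $ i $ j = ?A $ j $ i" for i j
    using tA by (metis transpose_def vec_lambda_beta)
  ultimately show ?thesis unfolding psd_on_def by blast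
qed

lemma pos_def_matrix_det_inv:
  fixes S :: "real^'n^'n"
  assumes "pos_def_matrix S"
  shows "det S * det (matrix_inv S) = 1"
  by (simp only: det_mul[symmetric] det_I matrix_inv_inverse(1)[OF pos_def_matrix_invertible[OF assms]])

text \<open>The Gram factor of the inverse serves as \<open>P\<close>. It turns the kernel into a
  standard Gaussian of linearly transformed points, so that \<open>psd_on_gaussian\<close>
  applies.\<close>

lemma pos_def_matrix_inv_norm:
  fixes S :: "real^'n^'n"
  assumes "pos_def_matrix S"
  obtains P :: "real^'n^'n" where "\<And>x. x \<bullet> (matrix_inv S *v x) = (norm (P *v x))\<^sup>2"
proof -
  obtain Q :: "'n \<Rightarrow> 'n \<Rightarrow> real"
    where "\<forall>i\<in>UNIV. \<forall>j\<in>UNIV. matrix_inv S $ i $ j = (\<Sum>b\<in>UNIV. Q b i * Q b j)"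
    using psd_on_gram[OF finite pos_def_matrix_psd_inv[OF assms]] by blast
  then have Q: "matrix_inv S $ i $ j = (\<Sum>b\<in>UNIV. Q b i * Q b j)" for i j
    by blast
  define P where "P = (\<chi> b i. Q b i)"
  have "x \<bullet> (matrix_inv S *v x) = (norm (P *v x))\<^sup>2" for x
  proof -
    have "x \<bullet> (matrix_inv S *v x) =
        (\<Sum>i\<in>UNIV. \<Sum>j\<in>UNIV. \<Sum>b\<in>UNIV. x $ i * x $ j * (Q b i * Q b j))"
      by (simp add: inner_matrix_vector Q sum_distrib_left)
    also have "\<dots> = (\<Sum>i\<in>UNIV. \<Sum>b\<in>UNIV. \<Sum>j\<in>UNIV. x $ i * x $ j * (Q b i * Q b j))"
      by (intro sum.cong refl sum.swap)
    also have "\<dots> = (\<Sum>b\<in>UNIV. \<Sum>i\<in>UNIV. \<Sum>j\<in>UNIV. x $ i * x $ j * (Q b i * Q b j))"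
      by (rule sum.swap)
    also have "\<dots> = (\<Sum>b\<in>UNIV. (\<Sum>i\<in>UNIV. Q b i * x $ i) * (\<Sum>j\<in>UNIV. Q b j * x $ j))"
      by (intro sum.cong refl) (simp add: sum_product mult_ac)
    also have "\<dots> = (norm (P *v x))\<^sup>2"
      by (simp add: power2_norm_eq_inner inner_vec_def matrix_vector_mult_def P_def)
    finally show ?thesis .
  qed
  then show ?thesis by (rule that)
qed

lemma nn_integral_gaussian_lborel:
  fixes A :: "real^'n^'n"
  assumes psd: "psd_on UNIV (\<lambda>i j. A $ i $ j)" and "det A \<noteq> 0"
  shows "(\<integral>\<^sup>+ x. ennreal (exp (- (1/2) * (x \<bullet> (A *v x)))) \<partial>lborel) =
    ennreal (sqrt (2 * pi) ^ CARD('n) / sqrt (det A))"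
proof -
  \<comment> \<open>The bilinear form of \<open>A\<close> on basis vectors: \<open>lborel\<close> is
    the image of a product measure indexed by \<open>Basis\<close>, not by the coordinate
    type.\<close>
  define A' where "A' b c = b \<bullet> (A *v c)" for b c :: "real^'n"
  have bij: "bij_betw (\<lambda>i. axis i 1) UNIV (Basis :: (real^'n) set)"
    by (auto simp: bij_betw_def inj_on_def axis_eq_axis Basis_vec_def)
  have "A' (axis i 1) (axis j 1) = A $ i $ j" for i j
    by (simp add: A'_def matrix_vector_mult_basis column_def inner_axis')
  then have det: "det_on Basis A' = det A"
    by (simp add: det_on_reindex[OF bij] det_eq_det_on)
  have form: "(\<Sum>b\<in>Basis. \<Sum>c\<in>Basis. f b * f c * A' b c) =
      (\<Sum>b\<in>Basis. f b *\<^sub>R b) \<bullet> (A *v (\<Sum>b\<in>Basis. f b *\<^sub>R b))" for f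
    unfolding A'_def
    by (subst sum.swap) (simp add: inner_sum_left inner_sum_right linear_sum[OF matrix_vector_mul_linear]
        linear_cmul[OF matrix_vector_mul_linear] sum_distrib_left mult_ac)
  have "psd_on Basis A'"
    unfolding psd_on_def
  proof (intro conjI allI ballI)
    fix b c :: "real^'n"
    have "A' b c = (\<Sum>i\<in>UNIV. \<Sum>j\<in>UNIV. b $ i * c $ j * A $ i $ j)"
      by (simp add: A'_def inner_matrix_vector)
    also have "\<dots> = (\<Sum>j\<in>UNIV. \<Sum>i\<in>UNIV. b $ i * c $ j * A $ i $ j)"
      by (rule sum.swap)
    also have "\<dots> = (\<Sum>j\<in>UNIV. \<Sum>i\<in>UNIV. c $ j * b $ i * A $ j $ i)"
    proof (intro sum.cong refl)
      fix i j
      have "A $ i $ j = A $ j $ i" using psd unfolding psd_on_def by blast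
      then show "b $ i * c $ j * A $ i $ j = c $ j * b $ i * A $ j $ i" by simp
    qed
    also have "\<dots> = A' c b"
      by (simp add: A'_def inner_matrix_vector)
    finally show "A' b c = A' c b" .
  next
    fix c :: "real^'n \<Rightarrow> real"
    show "0 \<le> (\<Sum>i\<in>Basis. \<Sum>j\<in>Basis. c i * c j * A' i j)"
      unfolding form inner_matrix_vector using psd unfolding psd_on_def by blast
  qed
  then have "(\<integral>\<^sup>+ x. ennreal (exp (- (1/2) * (\<Sum>i\<in>Basis. \<Sum>j\<in>Basis. x i * x j * A' i j))) \<partial>PiM Basis (\<lambda>_. lborel)) =
    ennreal (sqrt (2 * pi) ^ CARD('n) / sqrt (det A))"
    using nn_integral_gaussian_PiM[of Basis A'] det assms(2) by simp
  moreover have "(\<integral>\<^sup>+ x. ennreal (exp (- (1/2) * (x \<bullet> (A *v x)))) \<partial>lborel) =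
    (\<integral>\<^sup>+ x. ennreal (exp (- (1/2) * (\<Sum>i\<in>Basis. \<Sum>j\<in>Basis. x i * x j * A' i j))) \<partial>PiM Basis (\<lambda>_. lborel))"
    unfolding form by (subst lborel_eq, subst nn_integral_distr)
      (auto intro!: borel_measurable_continuous_onI continuous_intros matrix_vector_mult_linear_continuous_on)
  ultimately show ?thesis by simp
qed

section \<open>The normalized Gaussian kernel\<close>

context
  fixes S :: "real^'n^'n"
  assumes pd: "pos_def_matrix S"
    and norm1: "(2 * pi) powr (real CARD('n) / 2) * sqrt (det S) = 1"
begin

lemma gauss_kernel_eq: "gauss_kernel S x y = exp (- (1/2) * ((x - y) \<bullet> (matrix_inv S *v (x - y))))"
  using norm1 by (simp add: gauss_kernel_def)

lemma gauss_kernel_refl: "gauss_kernel S x x = 1"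
  by (simp add: gauss_kernel_eq)

lemma gauss_kernel_nonneg: "0 \<le> gauss_kernel S x y"
  by (simp add: gauss_kernel_eq)

lemma continuous_gauss_kernel: "continuous_on UNIV (\<lambda>(x, y). gauss_kernel S x y)"
  unfolding gauss_kernel_eq case_prod_beta
  by (intro continuous_intros bounded_linear.continuous_on[OF matrix_vector_mul_bounded_linear])

lemma psd_on_gauss_kernel: "psd_on I (\<lambda>i j. gauss_kernel S (x i) (x j))"
proof -
  obtain P :: "real^'n^'n" where P: "\<And>x. x \<bullet> (matrix_inv S *v x) = (norm (P *v x))\<^sup>2"
    using pos_def_matrix_inv_norm[OF pd] by blast
  show ?thesis
    using psd_on_gaussian[of I "\<lambda>i. P *v x i"]
    by (simp only: gauss_kernel_eq P) (simp only: matrix_vector_mult_diff_distrib)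
qed

text \<open>After a translation this is the Gaussian integral for \<open>matrix_inv S\<close>, whose
  value is exactly the normalizing constant. The result supplies the row bound of the Schur
  test.\<close>

lemma nn_integral_gauss_kernel: "(\<integral>\<^sup>+ y. ennreal (gauss_kernel S x y) \<partial>lborel) = 1"
proof -
  let ?q = "\<lambda>x. ennreal (exp (- (1/2) * (x \<bullet> (matrix_inv S *v x))))"
  have meas: "?q \<in> borel_measurable borel"
    by (auto intro!: borel_measurable_continuous_onI continuous_intros matrix_vector_mult_linear_continuous_on)
  have "(\<integral>\<^sup>+ y. ennreal (gauss_kernel S x y) \<partial>lborel) = (\<integral>\<^sup>+ y. ?q (- x + y) \<partial>lborel)"
  proof (rule nn_integral_cong)
    fix y
    have "(x - y) \<bullet> (matrix_inv S *v (x - y)) = (- x + y) \<bullet> (matrix_inv S *v (- x + y))"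
      by (simp add: matrix_vector_mult_diff_distrib inner_diff_left inner_diff_right algebra_simps)
    then show "ennreal (gauss_kernel S x y) = ?q (- x + y)"
      by (simp add: gauss_kernel_eq)
  qed
  also have "\<dots> = (\<integral>\<^sup>+ y. ?q y \<partial>distr lborel borel ((+) (- x)))"
    using meas by (subst nn_integral_distr) auto
  also have "distr lborel borel ((+) (- x)) = lborel"
    by (rule lborel_distr_plus)
  also have "(\<integral>\<^sup>+ y. ?q y \<partial>lborel) = ennreal (sqrt (2 * pi) ^ CARD('n) / sqrt (det (matrix_inv S)))"
    using pos_def_matrix_det_inv[OF pd]
    by (intro nn_integral_gaussian_lborel pos_def_matrix_psd_inv[OF pd]) auto
  also have "sqrt (2 * pi) ^ CARD('n) / sqrt (det (matrix_inv S)) = 1"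
  proof -
    have "det (matrix_inv S) = 1 / det S"
      using pos_def_matrix_det_inv[OF pd] by (metis nonzero_mult_div_cancel_left mult_zero_left zero_neq_one)
    moreover have "sqrt (2 * pi) ^ CARD('n) = (2 * pi) powr (real CARD('n) / 2)"
      by (simp add: powr_half_sqrt[symmetric] powr_powr powr_realpow[symmetric])
    ultimately show ?thesis using norm1 by (simp add: real_sqrt_divide)
  qed
  finally show ?thesis by simp
qed

end

section \<open>Averaging the correlation functions over cells\<close>

text \<open>Both measures agree on boxes, which determines a product measure. It serves to trade
  products of indicators under Lebesgue measure for uniform samples from the cells.\<close>

lemma PiM_density:
  assumes "finite I" and M: "\<And>i. sigma_finite_measure (M i)"
    and f [measurable]: "\<And>i. f i \<in> borel_measurable (M i)"
    and D: "\<And>i. sigma_finite_measure (density (M i) (f i))"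
  shows "PiM I (\<lambda>i. density (M i) (f i)) = density (PiM I M) (\<lambda>x. \<Prod>i\<in>I. f i (x i))"
proof -
  interpret M: product_sigma_finite M by (intro product_sigma_finite.intro M)
  interpret D: product_sigma_finite "\<lambda>i. density (M i) (f i)"
    by (intro product_sigma_finite.intro D)
  have meas: "(\<lambda>x. \<Prod>i\<in>I. f i (x i)) \<in> borel_measurable (PiM I M)"
    by measurable
  show ?thesis
  proof (rule D.PiM_eqI[symmetric, OF assms(1)])
    show "sets (density (PiM I M) (\<lambda>x. \<Prod>i\<in>I. f i (x i))) = sets (PiM I (\<lambda>i. density (M i) (f i)))"
      unfolding sets_density by (intro sets_PiM_cong) auto
    fix A assume "\<And>i. i \<in> I \<Longrightarrow> A i \<in> sets (density (M i) (f i))"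
    then have A: "\<And>i. i \<in> I \<Longrightarrow> A i \<in> sets (M i)" by simp
    have "emeasure (density (PiM I M) (\<lambda>x. \<Prod>i\<in>I. f i (x i))) (Pi\<^sub>E I A) =
        (\<integral>\<^sup>+ x. (\<Prod>i\<in>I. f i (x i)) * indicator (Pi\<^sub>E I A) x \<partial>PiM I M)"
      using A assms(1) meas by (intro emeasure_density sets_PiM_I_finite) auto
    also have "\<dots> = (\<integral>\<^sup>+ x. (\<Prod>i\<in>I. f i (x i) * indicator (A i) (x i)) \<partial>PiM I M)"
    proof (rule nn_integral_cong)
      fix x assume "x \<in> space (PiM I M)"
      then have "x \<in> extensional I" by (auto simp: space_PiM PiE_def)
      then have "indicator (Pi\<^sub>E I A) x = (\<Prod>i\<in>I. indicator (A i) (x i) :: ennreal)"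
        using assms(1) by (auto simp: indicator_def PiE_iff prod_zero_iff)
      then show "(\<Prod>i\<in>I. f i (x i)) * indicator (Pi\<^sub>E I A) x = (\<Prod>i\<in>I. f i (x i) * indicator (A i) (x i))"
        by (simp add: prod.distrib)
    qed
    also have "\<dots> = (\<Prod>i\<in>I. \<integral>\<^sup>+ y. f i y * indicator (A i) y \<partial>M i)"
      using A assms(1) by (intro M.product_nn_integral_prod) auto
    also have "\<dots> = (\<Prod>i\<in>I. emeasure (density (M i) (f i)) (A i))"
      using A by (intro prod.cong refl emeasure_density[symmetric]) auto
    finally show "emeasure (density (PiM I M) (\<lambda>x. \<Prod>i\<in>I. f i (x i))) (Pi\<^sub>E I A) =
      (\<Prod>i\<in>I. emeasure (density (M i) (f i)) (A i))" .
  qed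
qed

text \<open>Uniform distribution on \<open>A\<close>. Null cells get the Dirac measure at \<open>b\<close>, so that products of cell
  measures remain probability measures and the sampled points remain in a set containing \<open>b\<close>.\<close>

definition cell_measure :: "'a \<Rightarrow> 'a::euclidean_space set \<Rightarrow> 'a measure" where
  "cell_measure b A =
     (if emeasure lborel A = 0 then return borel b else uniform_measure lborel A)"

lemma sets_cell_measure [measurable_cong, simp]: "sets (cell_measure b A) = sets borel"
  by (simp add: cell_measure_def)

lemma space_cell_measure [simp]: "space (cell_measure b A) = UNIV"
  by (simp add: cell_measure_def)

lemma emeasure_lborel_bounded:
  assumes "bounded A"
  shows "emeasure lborel A < \<infinity>" "emeasure lborel A = ennreal (measure lborel A)"
  using emeasure_bounded_finite[OF assms] by (auto simp: emeasure_eq_ennreal_measure top.not_eq_extremum)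

lemma prob_space_cell_measure:
  assumes "bounded A" "A \<in> sets borel"
  shows "prob_space (cell_measure b A)"
  using emeasure_lborel_bounded(1)[OF assms(1)]
  by (auto simp: cell_measure_def intro!: prob_space_return prob_space_uniform_measure)

text \<open>Scaling the uniform law by the volume recovers Lebesgue measure restricted to the cell.
  For a null cell the factor 0 removes the Dirac measure and both sides are zero.\<close>

lemma density_cell_measure:
  assumes "bounded A" "A \<in> sets borel"
  shows "density (cell_measure b A) (\<lambda>_. ennreal (measure lborel A)) = density lborel (indicator A)"
proof (cases "emeasure lborel A = 0")
  case True
  then have "AE x in lborel. x \<notin> A" using assms by (subst AE_iff_null) (auto simp: null_sets_def)
  then have "density lborel (indicator A) = density lborel (\<lambda>_::'a. 0)"
    using assms(2) by (intro density_cong) (auto simp: indicator_def)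
  then show ?thesis
    using True by (intro measure_eqI) (auto simp: cell_measure_def measure_def emeasure_density)
next
  case False
  let ?e = "emeasure lborel A"
  have "density (cell_measure b A) (\<lambda>_. ennreal (measure lborel A)) =
      density lborel (\<lambda>x. indicator A x / ?e * ?e)"
    using False assms unfolding emeasure_lborel_bounded(2)[OF assms(1), symmetric]
    by (simp add: cell_measure_def uniform_measure_def density_density_eq)
  also have "\<dots> = density lborel (indicator A)"
    using False emeasure_lborel_bounded(1)[OF assms(1)] assms(2)
    by (intro density_cong) (auto simp: ennreal_divide_times indicator_def ennreal_divide_self)
  finally show ?thesis .
qed

text \<open>The sample from a null cell is \<open>b\<close>, which lies in \<open>B\<close> but
  perhaps not in the cell; hence the condition on the volume.\<close>

lemma AE_cell_measure:
  assumes "bounded A" "A \<in> sets borel" "B \<in> sets borel" "A \<subseteq> B" "b \<in> B"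
  shows "AE x in cell_measure b A. x \<in> B \<and> (measure lborel A \<noteq> 0 \<longrightarrow> x \<in> A)"
proof (cases "emeasure lborel A = 0")
  case True
  then have "measure lborel A = 0" by (simp add: measure_def)
  moreover have "AE x in return borel b. x \<in> B" using assms by (subst AE_return) auto
  ultimately show ?thesis
    unfolding cell_measure_def using True by simp
next
  case False
  have "AE x in uniform_measure lborel A. x \<in> A"
    using assms(2) by (intro AE_uniform_measureI) auto
  then have "AE x in uniform_measure lborel A. x \<in> B \<and> (measure lborel A \<noteq> 0 \<longrightarrow> x \<in> A)"
    by eventually_elim (use assms(4) in auto)
  then show ?thesis unfolding cell_measure_def using False by simp
qed

lemma kernel_det_eq_det_on: "kernel_det K k x = det_on {..<k} (\<lambda>i j. K (x i) (x j))"
  by (simp add: kernel_det_def det_on_def)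

lemma borel_measurable_det_on:
  assumes "\<And>i j. i \<in> I \<Longrightarrow> j \<in> I \<Longrightarrow> (\<lambda>x. A x i j) \<in> borel_measurable N"
  shows "(\<lambda>x. det_on I (A x)) \<in> borel_measurable N"
  unfolding det_on_def
  by (intro borel_measurable_sum borel_measurable_times borel_measurable_const borel_measurable_prod)
     (auto intro!: assms simp: permutes_in_image)

text \<open>The properties of the kernel from which the generating function bounds follow. The
  diagonal value 1 fixes the intensity, and \<open>K_row\<close> says that the kernel is
  sub-stochastic. The point \<open>b\<close> is where null cells are sampled.\<close>

locale bounded_dpp =
  fixes M :: "'b measure" and X :: "'b \<Rightarrow> 'a::euclidean_space set" and K :: "'a \<Rightarrow> 'a \<Rightarrow> real"
    and B :: "'a set" and b :: 'a
  assumes dpp: "is_DPP M X K"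
    and compact_B: "compact B" and b_in_B: "b \<in> B"
    and K_cont: "continuous_on UNIV (\<lambda>(x, y). K x y)"
    and K_diag: "K x x = 1"
    and K_nonneg: "0 \<le> K x y"
    and K_psd: "finite I \<Longrightarrow> psd_on (I :: nat set) (\<lambda>i j. K (p i) (p j))"
    and K_row: "(\<integral>\<^sup>+ y. ennreal (K x y) \<partial>lborel) \<le> 1"
begin

sublocale prob_space M
  using dpp by (simp add: is_DPP_def point_process_def)

lemma B_borel [measurable]: "B \<in> sets borel"
  using compact_B by (simp add: borel_compact)

lemma finite_points: "\<omega> \<in> space M \<Longrightarrow> bounded A \<Longrightarrow> finite (X \<omega> \<inter> A)"
  using dpp by (simp add: is_DPP_def point_process_def)

lemma measurable_pcount [measurable]: "A \<in> sets borel \<Longrightarrow> pcount X A \<in> measurable M (count_space UNIV)"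
  using dpp by (simp add: is_DPP_def point_process_def)

lemma K_meas: "(\<lambda>(x, y). K x y) \<in> borel_measurable (borel \<Otimes>\<^sub>M borel)"
  unfolding borel_prod using K_cont by (rule borel_measurable_continuous_onI)

lemma K_meas_PiM:
  assumes "i \<in> I" "j \<in> I" "\<And>i. i \<in> I \<Longrightarrow> sets (N i) = sets borel"
  shows "(\<lambda>x. K (x i) (x j)) \<in> borel_measurable (PiM I N)"
proof -
  have "(\<lambda>x. x k) \<in> measurable (PiM I N) borel" if "k \<in> I" for k
    using measurable_component_singleton[OF that, of N] measurable_cong_sets[OF refl assms(3)[OF that]]
    by blast
  then have "(\<lambda>x. (x i, x j)) \<in> measurable (PiM I N) (borel \<Otimes>\<^sub>M borel)"
    using assms by (intro measurable_Pair) auto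
  from measurable_compose[OF this K_meas] show ?thesis by simp
qed

lemma det_on_K_bounds:
  assumes "finite (I :: nat set)"
  shows "0 \<le> det_on I (\<lambda>i j. K (p i) (p j))" "det_on I (\<lambda>i j. K (p i) (p j)) \<le> 1"
  using hadamard_psd_on[OF assms K_psd[OF assms, of p]] by (auto simp: K_diag)

end

locale dpp_partition = bounded_dpp M X K B b
  for M :: "'b measure" and X :: "'b \<Rightarrow> 'a::euclidean_space set" and K B b +
  fixes m :: nat and A :: "nat \<Rightarrow> 'a set"
  assumes A_borel: "\<And>i. i < m \<Longrightarrow> A i \<in> sets borel"
    and A_disj: "\<And>i j. i < m \<Longrightarrow> j < m \<Longrightarrow> i \<noteq> j \<Longrightarrow> A i \<inter> A j = {}"
    and A_union: "(\<Union>i<m. A i) = B"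
begin

abbreviation "a i \<equiv> measure lborel (A i)"
abbreviation "cells \<equiv> PiM {..<m} (\<lambda>i. cell_measure b (A i))"

lemma A_sub: "i < m \<Longrightarrow> A i \<subseteq> B"
  using A_union by blast

lemma A_bounded: "i < m \<Longrightarrow> bounded (A i)"
  using A_sub compact_B bounded_subset compact_imp_bounded by metis

lemma prob_space_cells: "prob_space cells"
  by (intro prob_space_PiM prob_space_cell_measure A_bounded A_borel) auto

text \<open>The correlation function of order \<open>card S\<close> is applied to an enumeration of
  the cells in \<open>S\<close>, and the Lebesgue integral over each cell becomes its volume times a
  uniform average. Stating the result on the product over all cells lets every \<open>S\<close>
  share one probability space.\<close>

lemma correlation_cells:
  assumes S: "S \<subseteq> {..<m}" "S \<noteq> {}"
  shows "(\<integral>\<^sup>+ \<omega>. ennreal (\<Prod>i\<in>S. real (pcount X (A i) \<omega>)) \<partial>M) =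
    (\<integral>\<^sup>+ x. ennreal ((\<Prod>i\<in>S. a i) * det_on S (\<lambda>i j. K (x i) (x j))) \<partial>cells)"
proof -
  have fin: "finite S" using S finite_subset by blast
  define k where "k = card S"
  have "k \<ge> 1" using fin S(2) by (simp add: k_def Suc_le_eq card_gt_0_iff)
  obtain f where f: "bij_betw f {..<k} S"
    using ex_bij_betw_nat_finite[OF fin] by (auto simp: k_def atLeast0LessThan)
  \<comment> \<open>Padding with empty sets makes every \<open>A' i\<close> Borel and bounded, as
    \<open>PiM_density\<close> speaks of all indices.\<close>
  define A' where "A' i = (if i < k then A (f i) else {})" for i
  have fm: "f i < m" if "i < k" for i
    using f that S by (auto simp: bij_betw_def)
  have A'1: "A' i \<in> sets borel" "bounded (A' i)" for i
    using A_borel[OF fm] A_bounded[OF fm] by (auto simp: A'_def)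
  have A'2: "A' i \<inter> A' j = {}" if "i < k" "j < k" "i \<noteq> j" for i j
  proof -
    have "f i \<noteq> f j" using f that by (auto simp: bij_betw_def inj_on_def)
    then show ?thesis using A_disj fm that by (auto simp: A'_def)
  qed
  let ?P = "PiM {..<k} (\<lambda>_. lborel :: 'a measure)"
  let ?C = "PiM {..<k} (\<lambda>i. cell_measure b (A' i))"
  let ?d = "\<lambda>x. ennreal (kernel_det K k x)"
  let ?a = "\<Prod>i<k. ennreal (measure lborel (A' i))"
  have d_meas: "?d \<in> borel_measurable (PiM {..<k} N)" if "\<And>i. i < k \<Longrightarrow> sets (N i) = sets borel" for N
    unfolding kernel_det_eq_det_on using that
    by (intro measurable_compose[OF _ measurable_ennreal] borel_measurable_det_on K_meas_PiM) auto
  have ind_meas: "(\<lambda>x. \<Prod>i<k. indicator (A' i) (x i) :: ennreal) \<in> borel_measurable ?P"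
    using A'1 by (intro borel_measurable_prod_ennreal measurable_compose[OF measurable_component_singleton]) auto
  have sf: "sigma_finite_measure (density lborel (indicator (A' i) :: 'a \<Rightarrow> ennreal))" for i
  proof -
    have "emeasure (density lborel (indicator (A' i) :: 'a \<Rightarrow> ennreal)) (space (density lborel (indicator (A' i) :: 'a \<Rightarrow> ennreal)))
        = emeasure lborel (A' i)"
      using A'1 by (subst emeasure_density) (auto simp: nn_integral_indicator)
    then have "finite_measure (density lborel (indicator (A' i) :: 'a \<Rightarrow> ennreal))"
      using emeasure_lborel_bounded(1)[OF A'1(2)] by (intro finite_measureI) (simp add: less_top)
    then show ?thesis by (simp add: finite_measure.axioms)
  qed
  have ps: "prob_space (cell_measure b (A' i))" for i
    using A'1 by (intro prob_space_cell_measure)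
  have "(\<integral>\<^sup>+ \<omega>. (\<Prod>i<k. ennreal (real (pcount X (A' i) \<omega>))) \<partial>M) =
        (\<integral>\<^sup>+ x. ennreal ((\<Prod>i<k. indicator (A' i) (x i)) * kernel_det K k x) \<partial>?P)"
    using dpp \<open>k \<ge> 1\<close> A'1 A'2
    unfolding is_DPP_def has_correlation_functions_def by blast
  also have "\<dots> = (\<integral>\<^sup>+ x. (\<Prod>i<k. indicator (A' i) (x i)) * ?d x \<partial>?P)"
  proof (rule nn_integral_cong)
    fix x
    show "ennreal ((\<Prod>i<k. indicator (A' i) (x i)) * kernel_det K k x) =
        (\<Prod>i<k. indicator (A' i) (x i)) * ?d x"
      by (subst ennreal_mult') (auto simp: prod_nonneg prod_ennreal[symmetric] ennreal_indicator)
  qed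
  \<comment> \<open>The indicators move into the measure, which is then rewritten as
    \<open>?a\<close> times a product of cell measures.\<close>
  also have "\<dots> = (\<integral>\<^sup>+ x. ?d x \<partial>density ?P (\<lambda>x. \<Prod>i<k. indicator (A' i) (x i)))"
    using d_meas by (intro nn_integral_density[symmetric] ind_meas) simp
  also have "density ?P (\<lambda>x. \<Prod>i<k. indicator (A' i) (x i)) = PiM {..<k} (\<lambda>i. density lborel (indicator (A' i)))"
    using A'1 sf by (intro PiM_density[symmetric]) (auto simp: sigma_finite_lborel)
  also have "\<dots> = PiM {..<k} (\<lambda>i. density (cell_measure b (A' i)) (\<lambda>_. ennreal (measure lborel (A' i))))"
    using A'1 by (simp add: density_cell_measure)
  also have "\<dots> = density ?C (\<lambda>x. ?a)"
    using A'1 sf ps by (intro PiM_density) (auto simp: density_cell_measure prob_space_imp_sigma_finite)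
  also have "(\<integral>\<^sup>+ x. ?d x \<partial>density ?C (\<lambda>x. ?a)) = (\<integral>\<^sup>+ x. ?a * ?d x \<partial>?C)"
    using d_meas by (intro nn_integral_density) auto
  also have "?C = PiM {..<k} (\<lambda>i. cell_measure b (A (f i)))"
    by (intro PiM_cong) (auto simp: A'_def)
  \<comment> \<open>The product over the cells in \<open>S\<close> is a marginal of
    \<open>cells\<close>.\<close>
  also have "\<dots> = distr cells (PiM {..<k} (\<lambda>i. cell_measure b (A (f i)))) (\<lambda>\<omega>. \<lambda>n\<in>{..<k}. \<omega> (f n))"
    using f fm by (intro distr_PiM_reindex[symmetric] prob_space_cell_measure A_bounded A_borel)
      (auto simp: bij_betw_def)
  also have "(\<integral>\<^sup>+ x. ?a * ?d x \<partial>\<dots>) = (\<integral>\<^sup>+ \<omega>. ?a * ?d (\<lambda>n\<in>{..<k}. \<omega> (f n)) \<partial>cells)"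
    using d_meas fm by (intro nn_integral_distr measurable_restrict measurable_component_singleton) auto
  also have "\<dots> = (\<integral>\<^sup>+ x. ennreal ((\<Prod>i\<in>S. a i) * det_on S (\<lambda>i j. K (x i) (x j))) \<partial>cells)"
  proof (rule nn_integral_cong)
    fix x
    have "?a = ennreal (\<Prod>i<k. measure lborel (A' i))"
      by (simp add: prod_ennreal)
    also have "(\<Prod>i<k. measure lborel (A' i)) = (\<Prod>i<k. a (f i))"
      by (intro prod.cong) (auto simp: A'_def)
    also have "\<dots> = (\<Prod>i\<in>S. a i)"
      by (rule prod.reindex_bij_betw[OF f])
    finally have 1: "?a = ennreal (\<Prod>i\<in>S. a i)" .
    have "kernel_det K k (\<lambda>n\<in>{..<k}. x (f n)) = det_on {..<k} (\<lambda>i j. K (x (f i)) (x (f j)))"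
      unfolding kernel_det_eq_det_on by (rule det_on_cong) simp
    also have "\<dots> = det_on S (\<lambda>i j. K (x i) (x j))"
      by (rule det_on_reindex[OF f fin, symmetric])
    finally show "?a * ?d (\<lambda>n\<in>{..<k}. x (f n)) = ennreal ((\<Prod>i\<in>S. a i) * det_on S (\<lambda>i j. K (x i) (x j)))"
      unfolding 1 by (simp add: ennreal_mult' prod_nonneg)
  qed
  also have "(\<integral>\<^sup>+ \<omega>. (\<Prod>i<k. ennreal (real (pcount X (A' i) \<omega>))) \<partial>M) =
      (\<integral>\<^sup>+ \<omega>. ennreal (\<Prod>i\<in>S. real (pcount X (A i) \<omega>)) \<partial>M)"
  proof (rule nn_integral_cong)
    fix \<omega>
    have "(\<Prod>i<k. ennreal (real (pcount X (A' i) \<omega>))) = (\<Prod>i<k. ennreal (real (pcount X (A (f i)) \<omega>)))"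
      by (intro prod.cong) (auto simp: A'_def)
    also have "\<dots> = (\<Prod>i\<in>S. ennreal (real (pcount X (A i) \<omega>)))"
      by (rule prod.reindex_bij_betw[OF f])
    finally show "(\<Prod>i<k. ennreal (real (pcount X (A' i) \<omega>))) = ennreal (\<Prod>i\<in>S. real (pcount X (A i) \<omega>))"
      by (simp add: prod_ennreal)
  qed
  finally show ?thesis .
qed

end

section \<open>Positive semidefinite perturbations of the identity\<close>

lemma psd_on_one_plus:
  assumes "finite I" "psd_on I A"
  shows "psd_on I (\<lambda>i j. A i j + (if i = j then 1 else 0))"
  unfolding psd_on_def
proof (intro conjI ballI allI)
  fix i j assume "i \<in> I" "j \<in> I"
  then have "A i j = A j i" using assms unfolding psd_on_def by blast
  then show "A i j + (if i = j then 1 else 0) = A j i + (if j = i then 1 else 0)" by auto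
next
  fix c :: "'a \<Rightarrow> real"
  have "(\<Sum>i\<in>I. \<Sum>j\<in>I. c i * c j * (A i j + (if i = j then 1 else 0))) =
      (\<Sum>i\<in>I. \<Sum>j\<in>I. c i * c j * A i j) + (\<Sum>i\<in>I. c i * c i)"
    using assms(1) by (simp add: distrib_left sum.distrib if_distrib[of "\<lambda>x. _ * x"] cong: if_cong)
  moreover have "0 \<le> (\<Sum>i\<in>I. \<Sum>j\<in>I. c i * c j * A i j)"
    using assms(2) unfolding psd_on_def by blast
  moreover have "0 \<le> (\<Sum>i\<in>I. c i * c i)" by (intro sum_nonneg) simp
  ultimately show "0 \<le> (\<Sum>i\<in>I. \<Sum>j\<in>I. c i * c j * (A i j + (if i = j then 1 else 0)))" by linarith
qed

text \<open>The Schur test bounds the form of the weighted kernel by that of the identity: each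
  off-diagonal product is split by the inequality of arithmetic and geometric means, and the two
  halves are equal after summation by symmetry of \<open>K\<close>. The row bound finishes.\<close>

lemma psd_on_schur_test:
  assumes "finite I" "s \<ge> 0"
    and K: "\<And>i j. i \<in> I \<Longrightarrow> j \<in> I \<Longrightarrow> 0 \<le> K i j \<and> K i j = K j i"
    and row: "\<And>i. i \<in> I \<Longrightarrow> s * (\<Sum>j\<in>I. K i j * (w j)\<^sup>2) \<le> 1"
  shows "psd_on I (\<lambda>i j. - s * w i * w j * K i j + (if i = j then 1 else 0))"
  unfolding psd_on_def
proof (intro conjI ballI allI)
  fix i j assume "i \<in> I" "j \<in> I"
  then have "K i j = K j i" using K by blast
  then show "- s * w i * w j * K i j + (if i = j then 1 else 0) =
      - s * w j * w i * K j i + (if j = i then 1 else 0)" by simp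
next
  fix c :: "'a \<Rightarrow> real"
  have "(\<Sum>i\<in>I. \<Sum>j\<in>I. c i * c j * (w i * w j * K i j)) \<le>
      (\<Sum>i\<in>I. \<Sum>j\<in>I. (c i)\<^sup>2 * (K i j * (w j)\<^sup>2) / 2 + (c j)\<^sup>2 * (K j i * (w i)\<^sup>2) / 2)"
  proof (intro sum_mono)
    fix i j assume ij: "i \<in> I" "j \<in> I"
    \<comment> \<open>Pairing \<open>c i\<close> with \<open>w j\<close>, not with
      \<open>w i\<close>, is what makes the weighted row sums appear.\<close>
    have "0 \<le> (c i * w j - c j * w i)\<^sup>2" by simp
    then have "c i * c j * (w i * w j) \<le> (c i)\<^sup>2 * (w j)\<^sup>2 / 2 + (c j)\<^sup>2 * (w i)\<^sup>2 / 2"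
      by (simp add: power2_diff power_mult_distrib algebra_simps)
    then have "c i * c j * (w i * w j) * K i j \<le> ((c i)\<^sup>2 * (w j)\<^sup>2 / 2 + (c j)\<^sup>2 * (w i)\<^sup>2 / 2) * K i j"
      using K[OF ij] by (intro mult_right_mono) auto
    moreover have "K j i = K i j" using K[OF ij] by simp
    ultimately show "c i * c j * (w i * w j * K i j) \<le>
        (c i)\<^sup>2 * (K i j * (w j)\<^sup>2) / 2 + (c j)\<^sup>2 * (K j i * (w i)\<^sup>2) / 2"
      by (simp add: algebra_simps)
  qed
  also have "\<dots> = (\<Sum>i\<in>I. \<Sum>j\<in>I. (c i)\<^sup>2 * (K i j * (w j)\<^sup>2) / 2) +
      (\<Sum>i\<in>I. \<Sum>j\<in>I. (c j)\<^sup>2 * (K j i * (w i)\<^sup>2) / 2)"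
    by (simp add: sum.distrib)
  also have "(\<Sum>i\<in>I. \<Sum>j\<in>I. (c j)\<^sup>2 * (K j i * (w i)\<^sup>2) / 2) =
      (\<Sum>i\<in>I. \<Sum>j\<in>I. (c i)\<^sup>2 * (K i j * (w j)\<^sup>2) / 2)"
    by (rule sum.swap)
  also have "(\<Sum>i\<in>I. \<Sum>j\<in>I. (c i)\<^sup>2 * (K i j * (w j)\<^sup>2) / 2) + (\<Sum>i\<in>I. \<Sum>j\<in>I. (c i)\<^sup>2 * (K i j * (w j)\<^sup>2) / 2)
      = (\<Sum>i\<in>I. (c i)\<^sup>2 * (\<Sum>j\<in>I. K i j * (w j)\<^sup>2))"
    by (simp add: sum_divide_distrib[symmetric] sum_distrib_left[symmetric])
  finally have "s * (\<Sum>i\<in>I. \<Sum>j\<in>I. c i * c j * (w i * w j * K i j)) \<le>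
      s * (\<Sum>i\<in>I. (c i)\<^sup>2 * (\<Sum>j\<in>I. K i j * (w j)\<^sup>2))"
    using assms(2) by (rule mult_left_mono)
  also have "\<dots> = (\<Sum>i\<in>I. (c i)\<^sup>2 * (s * (\<Sum>j\<in>I. K i j * (w j)\<^sup>2)))"
    by (subst sum_distrib_left) (simp add: mult_ac)
  also have "\<dots> \<le> (\<Sum>i\<in>I. (c i)\<^sup>2 * 1)"
    using row by (intro sum_mono mult_left_mono) auto
  finally have "s * (\<Sum>i\<in>I. \<Sum>j\<in>I. c i * c j * (w i * w j * K i j)) \<le> (\<Sum>i\<in>I. c i * c i)"
    by (simp add: power2_eq_square)
  moreover have "(\<Sum>i\<in>I. \<Sum>j\<in>I. c i * c j * (- s * w i * w j * K i j + (if i = j then 1 else 0))) =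
      (\<Sum>i\<in>I. c i * c i) - s * (\<Sum>i\<in>I. \<Sum>j\<in>I. c i * c j * (w i * w j * K i j))"
  proof -
    have "c i * c j * (- s * w i * w j * K i j + (if i = j then 1 else 0)) =
      (if i = j then c i * c i else 0) - s * (c i * c j * (w i * w j * K i j))" for i j
      by (simp add: algebra_simps)
    then show ?thesis
      using assms(1) by (simp only: sum_subtractf sum_distrib_left[symmetric]) simp
  qed
  ultimately show "0 \<le> (\<Sum>i\<in>I. \<Sum>j\<in>I. c i * c j * (- s * w i * w j * K i j + (if i = j then 1 else 0)))"
    by simp
qed

section \<open>Expectation of the product over the cells\<close>

context dpp_partition
begin

text \<open>This is \<open>det (I + z L(x))\<close>. Distributing the volumes as square roots keeps
  \<open>L(x)\<close> symmetric, and its principal minors contain only the volumes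
  themselves.\<close>

definition det_cells :: "real \<Rightarrow> (nat \<Rightarrow> 'a) \<Rightarrow> real" where
  "det_cells z x = det_on {..<m} (\<lambda>i j. z * sqrt (a i) * sqrt (a j) * K (x i) (x j) + (if i = j then 1 else 0))"

lemma det_cells_expand:
  "det_cells z x = (\<Sum>S\<in>Pow {..<m}. z ^ card S * ((\<Prod>i\<in>S. a i) * det_on S (\<lambda>i j. K (x i) (x j))))"
proof -
  have "det_cells z x = (\<Sum>S\<in>Pow {..<m}. det_on S (\<lambda>i j. z * sqrt (a i) * sqrt (a j) * K (x i) (x j)))"
    unfolding det_cells_def by (rule det_on_one_plus) simp
  also have "\<dots> = (\<Sum>S\<in>Pow {..<m}. z ^ card S * ((\<Prod>i\<in>S. a i) * det_on S (\<lambda>i j. K (x i) (x j))))"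
  proof (rule sum.cong[OF refl])
    fix S
    have "det_on S (\<lambda>i j. z * sqrt (a i) * sqrt (a j) * K (x i) (x j)) =
        (\<Prod>i\<in>S. z * sqrt (a i) * sqrt (a i)) * det_on S (\<lambda>i j. K (x i) (x j))"
      by (rule det_on_scale)
    also have "(\<Prod>i\<in>S. z * sqrt (a i) * sqrt (a i)) = z ^ card S * (\<Prod>i\<in>S. a i)"
      by (simp add: prod.distrib mult.assoc)
    finally show "det_on S (\<lambda>i j. z * sqrt (a i) * sqrt (a j) * K (x i) (x j)) =
        z ^ card S * ((\<Prod>i\<in>S. a i) * det_on S (\<lambda>i j. K (x i) (x j)))" by simp
  qed
  finally show ?thesis .
qed

text \<open>Real integrals are needed because the expansion has signed terms for
  \<open>z < 0\<close>. Finiteness comes from the cell side, where determinants of the kernel are at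
  most 1.\<close>

lemma correlation_cells_integral:
  assumes S: "S \<subseteq> {..<m}"
  defines "f \<equiv> (\<lambda>\<omega>. \<Prod>i\<in>S. real (pcount X (A i) \<omega>))"
    and "g \<equiv> (\<lambda>x. (\<Prod>i\<in>S. a i) * det_on S (\<lambda>i j. K (x i) (x j)))"
  shows "integrable M f" "integrable cells g" "(\<integral>\<omega>. f \<omega> \<partial>M) = (\<integral>x. g x \<partial>cells)"
proof -
  interpret C: prob_space cells by (rule prob_space_cells)
  have fin: "finite S" using S finite_subset by blast
  have f_meas: "f \<in> borel_measurable M"
    unfolding f_def using S A_borel by (intro borel_measurable_prod) auto
  have f_nonneg: "0 \<le> f \<omega>" for \<omega> unfolding f_def by (intro prod_nonneg) auto
  have g_meas: "g \<in> borel_measurable cells"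
    unfolding g_def using S
    by (intro borel_measurable_times borel_measurable_const borel_measurable_det_on K_meas_PiM) auto
  have g_nonneg: "0 \<le> g x" for x
    unfolding g_def using det_on_K_bounds[OF fin] by (intro mult_nonneg_nonneg prod_nonneg) auto
  have g_le: "g x \<le> (\<Prod>i\<in>S. a i)" for x
    unfolding g_def using det_on_K_bounds(2)[OF fin, of x] by (intro mult_left_le prod_nonneg) auto
  have eq: "(\<integral>\<^sup>+ \<omega>. ennreal (f \<omega>) \<partial>M) = (\<integral>\<^sup>+ x. ennreal (g x) \<partial>cells)"
  \<comment> \<open>Correlation functions start at order 1; for the empty set both sides are the
    total mass 1.\<close>
  proof (cases "S = {}")
    case True
    then show ?thesis by (simp add: f_def g_def emeasure_space_1 C.emeasure_space_1)
  next
    case False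
    then show ?thesis unfolding f_def g_def using S by (intro correlation_cells)
  qed
  show gi: "integrable cells g"
    using g_meas g_nonneg g_le by (intro C.integrable_const_bound[where B = "\<Prod>i\<in>S. a i"]) auto
  have "(\<integral>\<^sup>+ \<omega>. ennreal (f \<omega>) \<partial>M) < \<infinity>"
    unfolding eq using nn_integral_eq_integral[OF gi] g_nonneg by simp
  then show "integrable M f"
    using f_meas f_nonneg by (intro integrableI_nonneg) auto
  show "(\<integral>\<omega>. f \<omega> \<partial>M) = (\<integral>x. g x \<partial>cells)"
    using f_meas g_meas f_nonneg g_nonneg eq by (simp add: integral_eq_nn_integral)
qed

text \<open>Both integrands expand over the subsets \<open>S\<close> of cells with weights
  \<open>z ^ card S\<close>, and the terms match by the correlation identity.\<close>

lemma expectation_prod_cells: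
  "integrable M (\<lambda>\<omega>. \<Prod>i<m. 1 + z * real (pcount X (A i) \<omega>))"
  "integrable cells (det_cells z)"
  "(\<integral>\<omega>. (\<Prod>i<m. 1 + z * real (pcount X (A i) \<omega>)) \<partial>M) = (\<integral>x. det_cells z x \<partial>cells)"
proof -
  have expand: "(\<Prod>i<m. 1 + z * real (pcount X (A i) \<omega>)) =
      (\<Sum>S\<in>Pow {..<m}. z ^ card S * (\<Prod>i\<in>S. real (pcount X (A i) \<omega>)))" for \<omega>
    using prod_add[of "{..<m}" "\<lambda>i. z * real (pcount X (A i) \<omega>)" "\<lambda>_. 1"]
    by (simp add: prod.distrib add.commute)
  note corr = correlation_cells_integral
  show "integrable M (\<lambda>\<omega>. \<Prod>i<m. 1 + z * real (pcount X (A i) \<omega>))"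
    unfolding expand using corr(1) by (intro Bochner_Integration.integrable_sum integrable_mult_right) auto
  show "integrable cells (det_cells z)"
    unfolding det_cells_expand[abs_def]
    using corr(2) by (intro Bochner_Integration.integrable_sum integrable_mult_right) auto
  have "(\<integral>\<omega>. (\<Prod>i<m. 1 + z * real (pcount X (A i) \<omega>)) \<partial>M) =
      (\<Sum>S\<in>Pow {..<m}. z ^ card S * (\<integral>\<omega>. (\<Prod>i\<in>S. real (pcount X (A i) \<omega>)) \<partial>M))"
    unfolding expand using corr(1)
    by (subst Bochner_Integration.integral_sum) (auto intro!: integrable_mult_right)
  also have "\<dots> = (\<Sum>S\<in>Pow {..<m}. z ^ card S *
      (\<integral>x. (\<Prod>i\<in>S. a i) * det_on S (\<lambda>i j. K (x i) (x j)) \<partial>cells))"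
    using corr(3) by (intro sum.cong refl) (simp only: Pow_iff)
  also have "\<dots> = (\<integral>x. det_cells z x \<partial>cells)"
    unfolding det_cells_expand using corr(2)
    by (subst Bochner_Integration.integral_sum) (auto intro!: integrable_mult_right simp del: integral_mult_right_zero)
  finally show "(\<integral>\<omega>. (\<Prod>i<m. 1 + z * real (pcount X (A i) \<omega>)) \<partial>M) = (\<integral>x. det_cells z x \<partial>cells)" .
qed

lemma sum_a: "(\<Sum>i<m. a i) = measure lborel B"
proof -
  have "measure lborel (\<Union>i\<in>{..<m}. A i) = (\<Sum>i<m. a i)"
  proof (rule measure_finite_Union)
    show "disjoint_family_on A {..<m}" using A_disj by (auto simp: disjoint_family_on_def)
    show "emeasure lborel (A i) \<noteq> \<infinity>" if "i \<in> {..<m}" for i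
      using emeasure_lborel_bounded(1)[OF A_bounded] that by force
  qed (use A_borel in auto)
  then show ?thesis using A_union by simp
qed

text \<open>Hadamard's inequality bounds \<open>det_cells\<close> by the product of the diagonal
  entries \<open>1 + z * a i\<close>, each at most \<open>exp (z * a i)\<close>; the volumes add up
  to that of \<open>B\<close>. Semidefiniteness is only demanded at almost surely attained sample
  points.\<close>

lemma expectation_prod_le:
  assumes psd: "\<And>x. (\<And>i. i < m \<Longrightarrow> x i \<in> B \<and> (a i \<noteq> 0 \<longrightarrow> x i \<in> A i)) \<Longrightarrow>
    psd_on {..<m} (\<lambda>i j. z * sqrt (a i) * sqrt (a j) * K (x i) (x j) + (if i = j then 1 else 0))"
  shows "(\<integral>\<omega>. (\<Prod>i<m. 1 + z * real (pcount X (A i) \<omega>)) \<partial>M) \<le> exp (z * measure lborel B)"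
  unfolding expectation_prod_cells(3)
proof (rule prob_space.integral_le_const[OF prob_space_cells expectation_prod_cells(2)])
  have "AE x in cells. \<forall>i\<in>{..<m}. x i \<in> B \<and> (a i \<noteq> 0 \<longrightarrow> x i \<in> A i)"
  proof (rule AE_finite_allI)
    fix i assume i: "i \<in> {..<m}"
    show "AE x in cells. x i \<in> B \<and> (a i \<noteq> 0 \<longrightarrow> x i \<in> A i)"
      using i b_in_B A_bounded A_borel A_sub
      by (intro AE_PiM_component AE_cell_measure prob_space_cell_measure) auto
  qed simp
  then show "AE x in cells. det_cells z x \<le> exp (z * measure lborel B)"
  proof eventually_elim
    case (elim x)
    let ?G = "\<lambda>i j. z * sqrt (a i) * sqrt (a j) * K (x i) (x j) + (if i = j then 1 else 0)"
    have psdG: "psd_on {..<m} ?G"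
      using elim by (intro psd) auto
    have diag: "?G i i = 1 + z * a i" for i
      by (simp add: K_diag mult.assoc)
    have "det_cells z x \<le> (\<Prod>i<m. ?G i i)"
      unfolding det_cells_def using hadamard_psd_on[OF finite_lessThan psdG] by (rule conjunct2)
    also have "\<dots> \<le> (\<Prod>i<m. exp (z * a i))"
    proof (intro prod_mono conjI)
      fix i assume i: "i \<in> {..<m}"
      show "0 \<le> ?G i i"
        by (rule psd_on_diag_nonneg[OF psdG i finite_lessThan])
      show "?G i i \<le> exp (z * a i)"
        unfolding diag by (rule exp_ge_add_one_self)
    qed
    also have "\<dots> = exp (z * measure lborel B)"
      by (simp add: exp_sum[symmetric] sum_distrib_left[symmetric] sum_a)
    finally show ?case .
  qed
qed

lemma expectation_prod_le_pos:
  assumes "z \<ge> 0"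
  shows "(\<integral>\<omega>. (\<Prod>i<m. 1 + z * real (pcount X (A i) \<omega>)) \<partial>M) \<le> exp (z * measure lborel B)"
proof (rule expectation_prod_le)
  fix x :: "nat \<Rightarrow> 'a"
  have "psd_on {..<m} (\<lambda>i j. (sqrt z * sqrt (a i)) * (sqrt z * sqrt (a j)) * K (x i) (x j))"
    by (rule psd_on_scale[OF K_psd]) simp
  moreover have "(sqrt z * u) * (sqrt z * v) * k = z * u * v * k" for u v k
  proof -
    have "(sqrt z * u) * (sqrt z * v) * k = (sqrt z * sqrt z) * u * v * k" by (simp only: mult_ac)
    then show ?thesis using assms by simp
  qed
  ultimately have "psd_on {..<m} (\<lambda>i j. z * sqrt (a i) * sqrt (a j) * K (x i) (x j))"
    by simp
  then show "psd_on {..<m} (\<lambda>i j. z * sqrt (a i) * sqrt (a j) * K (x i) (x j) + (if i = j then 1 else 0))"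
    by (intro psd_on_one_plus) auto
qed

text \<open>With weights \<open>sqrt (a j)\<close> the row sum in the Schur test is a Riemann sum of
  \<open>K (x i)\<close> over \<open>B\<close>. It exceeds the integral, which is at most 1, by no
  more than the oscillation \<open>\<eta>\<close> times the volume.\<close>

lemma expectation_prod_le_neg:
  assumes "s \<ge> 0" "\<eta> \<ge> 0" "s * (1 + \<eta> * measure lborel B) \<le> 1"
    and osc: "\<And>x y y' i. x \<in> B \<Longrightarrow> i < m \<Longrightarrow> y \<in> A i \<Longrightarrow> y' \<in> A i \<Longrightarrow> K x y \<le> K x y' + \<eta>"
  shows "(\<integral>\<omega>. (\<Prod>i<m. 1 - s * real (pcount X (A i) \<omega>)) \<partial>M) \<le> exp (- s * measure lborel B)"
proof -
  have row: "(\<Sum>j<m. K (x i) (x j) * (sqrt (a j))\<^sup>2) \<le> 1 + \<eta> * measure lborel B"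
    if x: "\<And>i. i < m \<Longrightarrow> x i \<in> B \<and> (a i \<noteq> 0 \<longrightarrow> x i \<in> A i)" and i: "i < m" for x i
  proof -
    have K_m [measurable]: "K (x i) \<in> borel_measurable borel"
      using measurable_compose[OF measurable_Pair1' K_meas, of "x i"] by simp
    have "ennreal (\<Sum>j<m. K (x i) (x j) * (sqrt (a j))\<^sup>2) = (\<Sum>j<m. ennreal (K (x i) (x j) * a j))"
      by (simp add: K_nonneg sum_ennreal)
    also have "\<dots> \<le> (\<Sum>j<m. \<integral>\<^sup>+ y. (ennreal (K (x i) y) + ennreal \<eta>) * indicator (A j) y \<partial>lborel)"
    proof (rule sum_mono)
      fix j assume j: "j \<in> {..<m}"
      show "ennreal (K (x i) (x j) * a j) \<le> (\<integral>\<^sup>+ y. (ennreal (K (x i) y) + ennreal \<eta>) * indicator (A j) y \<partial>lborel)"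
      \<comment> \<open>A null cell contributes nothing; otherwise \<open>x j\<close> lies in its
        cell and the oscillation bound applies there.\<close>
      proof (cases "a j = 0")
        case False
        then have xj: "x j \<in> A j" using x j by auto
        have "ennreal (K (x i) (x j) * a j) = ennreal (K (x i) (x j)) * emeasure lborel (A j)"
          using j by (simp add: emeasure_lborel_bounded(2)[OF A_bounded] ennreal_mult'' )
        also have "\<dots> = (\<integral>\<^sup>+ y. ennreal (K (x i) (x j)) * indicator (A j) y \<partial>lborel)"
          using j A_borel by (simp add: nn_integral_cmult_indicator)
        also have "\<dots> \<le> (\<integral>\<^sup>+ y. (ennreal (K (x i) y) + ennreal \<eta>) * indicator (A j) y \<partial>lborel)"
        proof (rule nn_integral_mono)
          fix y
          show "ennreal (K (x i) (x j)) * indicator (A j) y \<le> (ennreal (K (x i) y) + ennreal \<eta>) * indicator (A j) y"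
            using osc[of "x i" j "x j" y] x[OF i] xj j assms(2)
            by (auto simp: indicator_def K_nonneg simp flip: ennreal_plus)
        qed
        finally show ?thesis .
      qed simp
    qed
    also have "\<dots> = (\<integral>\<^sup>+ y. (\<Sum>j<m. (ennreal (K (x i) y) + ennreal \<eta>) * indicator (A j) y) \<partial>lborel)"
      using A_borel by (intro nn_integral_sum[symmetric]) auto
    also have "\<dots> = (\<integral>\<^sup>+ y. (ennreal (K (x i) y) + ennreal \<eta>) * indicator B y \<partial>lborel)"
    proof (rule nn_integral_cong)
      fix y
      have "disjoint_family_on A {..<m}" using A_disj by (auto simp: disjoint_family_on_def)
      then have "(\<Sum>j<m. indicator (A j) y :: ennreal) = indicator B y"
        using A_union by (simp add: indicator_UN_disjoint[symmetric])
      then show "(\<Sum>j<m. (ennreal (K (x i) y) + ennreal \<eta>) * indicator (A j) y) = (ennreal (K (x i) y) + ennreal \<eta>) * indicator B y"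
        by (simp add: sum_distrib_left[symmetric])
    qed
    also have "\<dots> \<le> (\<integral>\<^sup>+ y. ennreal (K (x i) y) + ennreal \<eta> * indicator B y \<partial>lborel)"
      by (intro nn_integral_mono) (auto simp: indicator_def)
    also have "\<dots> = (\<integral>\<^sup>+ y. ennreal (K (x i) y) \<partial>lborel) + ennreal \<eta> * emeasure lborel B"
      by (subst nn_integral_add) (auto simp: nn_integral_cmult_indicator)
    also have "\<dots> \<le> 1 + ennreal \<eta> * ennreal (measure lborel B)"
      using K_row by (intro add_mono) (auto simp: emeasure_lborel_bounded(2)[OF compact_imp_bounded[OF compact_B]])
    also have "\<dots> = ennreal (1 + \<eta> * measure lborel B)"
      using assms(2) by (simp add: ennreal_plus ennreal_mult)
    finally show ?thesis using assms(2) by (subst (asm) ennreal_le_iff) auto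
  qed
  have "(\<integral>\<omega>. (\<Prod>i<m. 1 + (- s) * real (pcount X (A i) \<omega>)) \<partial>M) \<le> exp (- s * measure lborel B)"
  proof (rule expectation_prod_le)
    fix x :: "nat \<Rightarrow> 'a" assume x: "\<And>i. i < m \<Longrightarrow> x i \<in> B \<and> (a i \<noteq> 0 \<longrightarrow> x i \<in> A i)"
    show "psd_on {..<m} (\<lambda>i j. - s * sqrt (a i) * sqrt (a j) * K (x i) (x j) + (if i = j then 1 else 0))"
    proof (rule psd_on_schur_test)
      fix i j assume "i \<in> {..<m}" "j \<in> {..<m}"
      then have "K (x i) (x j) = K (x j) (x i)"
        using K_psd[OF finite_lessThan, of m x] unfolding psd_on_def by blast
      then show "0 \<le> K (x i) (x j) \<and> K (x i) (x j) = K (x j) (x i)"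
        using K_nonneg by blast
    next
      fix i assume "i \<in> {..<m}"
      then have "s * (\<Sum>j<m. K (x i) (x j) * (sqrt (a j))\<^sup>2) \<le> s * (1 + \<eta> * measure lborel B)"
        using assms(1) by (intro mult_left_mono row x) auto
      then show "s * (\<Sum>j<m. K (x i) (x j) * (sqrt (a j))\<^sup>2) \<le> 1"
        using assms(3) by linarith
    qed (use assms in auto)
  qed
  then show ?thesis by simp
qed

end

section \<open>Generating function of the number of points\<close>

text \<open>A finite cover by balls of radius \<open>e / 2\<close> is made disjoint by assigning
  each point to the first ball that contains it.\<close>

lemma compact_borel_partition:
  fixes B :: "'a::euclidean_space set"
  assumes "compact B" "e > 0"
  obtains m :: nat and A where "\<And>i. i < m \<Longrightarrow> A i \<in> sets borel"
    "\<And>i j. i < m \<Longrightarrow> j < m \<Longrightarrow> i \<noteq> j \<Longrightarrow> A i \<inter> A j = {}" "(\<Union>i<m. A i) = B"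
    "\<And>i x y. i < m \<Longrightarrow> x \<in> A i \<Longrightarrow> y \<in> A i \<Longrightarrow> dist x y < e"
proof -
  obtain C where C: "finite C" "B \<subseteq> (\<Union>c\<in>C. ball c (e / 2))"
    using seq_compact_imp_totally_bounded assms unfolding compact_eq_seq_compact_metric
    by (metis half_gt_zero)
  obtain h where h: "bij_betw h {..<card C} C"
    using ex_bij_betw_nat_finite[OF C(1)] by (auto simp: atLeast0LessThan)
  define A where "A i = (B \<inter> ball (h i) (e / 2)) - (\<Union>j<i. ball (h j) (e / 2))" for i :: nat
  have "A i \<in> sets borel" for i
    unfolding A_def using borel_compact[OF assms(1)] by (intro sets.Diff sets.Int sets.finite_UN) auto
  moreover have "A i \<inter> A j = {}" if "i \<noteq> j" for i j
    using that by (cases i j rule: linorder_cases) (auto simp: A_def)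
  moreover have "(\<Union>i<card C. A i) = B"
  proof
    show "B \<subseteq> (\<Union>i<card C. A i)"
    proof
      fix x assume x: "x \<in> B"
      define P where "P i \<longleftrightarrow> i < card C \<and> x \<in> ball (h i) (e / 2)" for i
      have "\<exists>i. P i"
        using C(2) h x by (auto simp: P_def bij_betw_def image_iff subset_iff) (metis imageE lessThan_iff mem_ball)
      then have "P (Least P)" "\<And>j. j < Least P \<Longrightarrow> \<not> P j"
        using LeastI_ex not_less_Least by blast+
      then show "x \<in> (\<Union>i<card C. A i)"
        using x by (auto simp: P_def A_def intro!: bexI[of _ "Least P"])
    qed
  qed (auto simp: A_def)
  moreover have "dist x y < e" if "x \<in> A i" "y \<in> A i" for i x y
  proof -
    have "dist (h i) x < e / 2" "dist (h i) y < e / 2" using that by (auto simp: A_def)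
    then show ?thesis using dist_triangle3[of x y "h i"] by simp
  qed
  ultimately show ?thesis using that[of "card C" A] by blast
qed

lemma finite_separated:
  fixes F :: "'a::metric_space set"
  assumes "finite F"
  obtains d where "d > 0" "\<And>x y. x \<in> F \<Longrightarrow> y \<in> F \<Longrightarrow> dist x y < d \<Longrightarrow> x = y"
proof -
  \<comment> \<open>The extra element 1 keeps the minimum defined when there are no two distinct
    points.\<close>
  define D where "D = insert 1 ((\<lambda>(x, y). dist x y) ` {(x, y) \<in> F \<times> F. x \<noteq> y})"
  have "finite {(x, y) \<in> F \<times> F. x \<noteq> y}"
    by (rule finite_subset[of _ "F \<times> F"]) (use assms in auto)
  then have fin: "finite D" "D \<noteq> {}" by (auto simp: D_def)
  have "Min D > 0" using fin by (auto simp: D_def)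
  moreover have "x = y" if "x \<in> F" "y \<in> F" "dist x y < Min D" for x y
  proof (rule ccontr)
    assume "x \<noteq> y"
    then have "dist x y \<in> D" using that by (force simp: D_def)
    then have "Min D \<le> dist x y" using fin by simp
    then show False using that(3) by simp
  qed
  ultimately show ?thesis by (rule that)
qed

section \<open>Point counts in the cells\<close>

context dpp_partition
begin

lemma sum_pcount:
  assumes "\<omega> \<in> space M"
  shows "(\<Sum>i<m. pcount X (A i) \<omega>) = pcount X B \<omega>"
proof -
  have "pcount X B \<omega> = card (\<Union>i<m. X \<omega> \<inter> A i)"
    unfolding pcount_def by (subst A_union[symmetric]) (simp only: Int_UN_distrib)
  also have "\<dots> = (\<Sum>i<m. card (X \<omega> \<inter> A i))"
    using A_disj finite_points[OF assms A_bounded] by (intro card_UN_disjoint) auto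
  finally show ?thesis by (simp add: pcount_def)
qed

text \<open>\<open>1 + z * k\<close> and \<open>(1 + z) ^ k\<close> agree for \<open>k = 0\<close>
  and \<open>k = 1\<close>.\<close>

lemma prod_cells_eq:
  assumes "\<omega> \<in> space M" "\<And>i. i < m \<Longrightarrow> pcount X (A i) \<omega> \<le> 1"
  shows "(\<Prod>i<m. 1 + z * real (pcount X (A i) \<omega>)) = (1 + z) ^ pcount X B \<omega>"
proof -
  have "(\<Prod>i<m. 1 + z * real (pcount X (A i) \<omega>)) = (\<Prod>i<m. (1 + z) ^ pcount X (A i) \<omega>)"
  proof (intro prod.cong refl)
    fix i assume "i \<in> {..<m}"
    then have "pcount X (A i) \<omega> = 0 \<or> pcount X (A i) \<omega> = 1" using assms(2)[of i] by auto
    then show "1 + z * real (pcount X (A i) \<omega>) = (1 + z) ^ pcount X (A i) \<omega>" by auto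
  qed
  also have "\<dots> = (1 + z) ^ pcount X B \<omega>"
    by (simp add: power_sum[symmetric] sum_pcount[OF assms(1)])
  finally show ?thesis .
qed

text \<open>From \<open>1 + k \<le> 2 ^ k\<close> in each cell. The bound does not depend on the
  partition, as dominated convergence requires.\<close>

lemma prod_cells_abs_le:
  assumes "\<omega> \<in> space M" "\<bar>z\<bar> \<le> 1"
  shows "\<bar>\<Prod>i<m. 1 + z * real (pcount X (A i) \<omega>)\<bar> \<le> 2 ^ pcount X B \<omega>"
proof -
  have "\<bar>\<Prod>i<m. 1 + z * real (pcount X (A i) \<omega>)\<bar> = (\<Prod>i<m. \<bar>1 + z * real (pcount X (A i) \<omega>)\<bar>)"
    by (rule abs_prod)
  also have "\<dots> \<le> (\<Prod>i<m. 2 ^ pcount X (A i) \<omega>)"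
  proof (intro prod_mono conjI)
    fix i
    let ?c = "pcount X (A i) \<omega>"
    have "\<bar>1 + z * real ?c\<bar> \<le> 1 + \<bar>z\<bar> * real ?c"
      using abs_triangle_ineq[of 1 "z * real ?c"] by (simp add: abs_mult)
    also have "\<dots> \<le> 1 + real ?c" using assms(2) by (simp add: mult_left_le_one_le)
    also have "\<dots> \<le> 2 ^ ?c" using Bernoulli_inequality[of 1 ?c] by simp
    finally show "\<bar>1 + z * real ?c\<bar> \<le> 2 ^ ?c" .
  qed simp
  also have "\<dots> = 2 ^ pcount X B \<omega>"
    by (simp add: power_sum[symmetric] sum_pcount[OF assms(1)])
  finally show ?thesis .
qed

end

section \<open>Passage to the limit along refining mesh sizes\<close>

context bounded_dpp
begin

lemma ex_fine_partitions:
  obtains m :: "nat \<Rightarrow> nat" and A :: "nat \<Rightarrow> nat \<Rightarrow> 'a set"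
  where "\<And>n. dpp_partition M X K B b (m n) (A n)"
    "\<And>n i x y. i < m n \<Longrightarrow> x \<in> A n i \<Longrightarrow> y \<in> A n i \<Longrightarrow> dist x y < 1 / Suc n"
proof -
  have "\<exists>mA. dpp_partition M X K B b (fst mA) (snd mA) \<and>
      (\<forall>i x y. i < fst mA \<longrightarrow> x \<in> snd mA i \<longrightarrow> y \<in> snd mA i \<longrightarrow> dist x y < 1 / Suc n)" for n :: nat
  proof -
    have "0 < 1 / real (Suc n)" by simp
    then obtain m :: nat and A where A: "\<And>i. i < m \<Longrightarrow> A i \<in> sets borel"
      "\<And>i j. i < m \<Longrightarrow> j < m \<Longrightarrow> i \<noteq> j \<Longrightarrow> A i \<inter> A j = {}" "(\<Union>i<m. A i) = B"
      "\<And>i x y. i < m \<Longrightarrow> x \<in> A i \<Longrightarrow> y \<in> A i \<Longrightarrow> dist x y < 1 / Suc n"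
      by (rule compact_borel_partition[OF compact_B]) (rule that)
    have "dpp_partition M X K B b m A"
      by unfold_locales (use A in auto)
    then show ?thesis using A(4) by (intro exI[of _ "(m, A)"]) auto
  qed
  then have "\<exists>f. \<forall>n. dpp_partition M X K B b (fst (f n)) (snd (f n)) \<and>
      (\<forall>i x y. i < fst (f n) \<longrightarrow> x \<in> snd (f n) i \<longrightarrow> y \<in> snd (f n) i \<longrightarrow> dist x y < 1 / Suc n)"
    by (intro choice) blast
  then obtain f where "\<And>n. dpp_partition M X K B b (fst (f n)) (snd (f n))"
      "\<And>n i x y. i < fst (f n) \<Longrightarrow> x \<in> snd (f n) i \<Longrightarrow> y \<in> snd (f n) i \<Longrightarrow> dist x y < 1 / Suc n"
    by blast
  then show ?thesis by (rule that)
qed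

text \<open>The finitely many points in \<open>B\<close> have a positive minimal distance; once the
  mesh is below it, no cell holds two of them.\<close>

lemma eventually_prod_cells_eq:
  fixes m :: "nat \<Rightarrow> nat" and A :: "nat \<Rightarrow> nat \<Rightarrow> 'a set"
  assumes part: "\<And>n. dpp_partition M X K B b (m n) (A n)"
    and mesh: "\<And>n i x y. i < m n \<Longrightarrow> x \<in> A n i \<Longrightarrow> y \<in> A n i \<Longrightarrow> dist x y < 1 / Suc n"
    and \<omega>: "\<omega> \<in> space M"
  shows "\<forall>\<^sub>F n in sequentially. (\<Prod>i<m n. 1 + z * real (pcount X (A n i) \<omega>)) = (1 + z) ^ pcount X B \<omega>"
proof -
  have bB: "bounded B" using compact_B by (rule compact_imp_bounded)
  obtain d where d: "d > 0" "\<And>x y. x \<in> X \<omega> \<inter> B \<Longrightarrow> y \<in> X \<omega> \<inter> B \<Longrightarrow> dist x y < d \<Longrightarrow> x = y"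
    using finite_separated[OF finite_points[OF \<omega> bB]] by blast
  have "(\<lambda>n. 1 / real (Suc n)) \<longlonglongrightarrow> 0" by (rule LIMSEQ_Suc[OF lim_1_over_n])
  then have "\<forall>\<^sub>F n in sequentially. 1 / real (Suc n) < d" using d(1) by (rule order_tendstoD)
  then show ?thesis
  proof eventually_elim
    case (elim n)
    interpret P: dpp_partition M X K B b "m n" "A n" by (rule part)
    show ?case
    proof (rule P.prod_cells_eq[OF \<omega>])
      fix i assume i: "i < m n"
      have "x = y" if "x \<in> X \<omega> \<inter> A n i" "y \<in> X \<omega> \<inter> A n i" for x y
        using d(2)[of x y] mesh[OF i, of x y] P.A_sub[OF i] that elim by fastforce
      then show "pcount X (A n i) \<omega> \<le> 1"
        unfolding pcount_def using card_le_Suc0_iff_eq[OF finite_points[OF \<omega> P.A_bounded[OF i]]] by auto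
    qed
  qed
qed

text \<open>The cell products are nonnegative and, for each outcome, eventually constant in
  \<open>n\<close>; Fatou's lemma carries their uniform bound over to the limit.\<close>

lemma expectation_power_pos:
  assumes "z \<ge> 0"
  shows "integrable M (\<lambda>\<omega>. (1 + z) ^ pcount X B \<omega>)"
    and "(\<integral>\<omega>. (1 + z) ^ pcount X B \<omega> \<partial>M) \<le> exp (z * measure lborel B)"
proof -
  obtain m :: "nat \<Rightarrow> nat" and A :: "nat \<Rightarrow> nat \<Rightarrow> 'a set"
    where part: "\<And>n. dpp_partition M X K B b (m n) (A n)"
      and mesh: "\<And>n i x y. i < m n \<Longrightarrow> x \<in> A n i \<Longrightarrow> y \<in> A n i \<Longrightarrow> dist x y < 1 / Suc n"
    by (rule ex_fine_partitions) (rule that)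
  define Z where "Z n \<omega> = (\<Prod>i<m n. 1 + z * real (pcount X (A n i) \<omega>))" for n \<omega>
  have Zi: "integrable M (Z n)" for n
    unfolding Z_def by (rule dpp_partition.expectation_prod_cells(1)[OF part])
  have Z_nonneg: "0 \<le> Z n \<omega>" for n \<omega>
    unfolding Z_def using assms by (intro prod_nonneg) auto
  have Z_le: "(\<integral>\<^sup>+ \<omega>. ennreal (Z n \<omega>) \<partial>M) \<le> ennreal (exp (z * measure lborel B))" for n
    using dpp_partition.expectation_prod_le_pos[OF part assms, of n]
    by (subst nn_integral_eq_integral[OF Zi]) (auto simp: Z_nonneg Z_def[symmetric])
  have "(\<integral>\<^sup>+ \<omega>. ennreal ((1 + z) ^ pcount X B \<omega>) \<partial>M) = (\<integral>\<^sup>+ \<omega>. liminf (\<lambda>n. ennreal (Z n \<omega>)) \<partial>M)"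
  proof (rule nn_integral_cong)
    fix \<omega> assume \<omega>: "\<omega> \<in> space M"
    have "\<forall>\<^sub>F n in sequentially. Z n \<omega> = (1 + z) ^ pcount X B \<omega>"
      unfolding Z_def using part mesh \<omega> by (rule eventually_prod_cells_eq)
    then have "\<forall>\<^sub>F n in sequentially. ennreal (Z n \<omega>) = ennreal ((1 + z) ^ pcount X B \<omega>)"
      by eventually_elim simp
    then have "(\<lambda>n. ennreal (Z n \<omega>)) \<longlonglongrightarrow> ennreal ((1 + z) ^ pcount X B \<omega>)"
      by (rule tendsto_eventually)
    then show "ennreal ((1 + z) ^ pcount X B \<omega>) = liminf (\<lambda>n. ennreal (Z n \<omega>))"
      by (intro lim_imp_Liminf[symmetric]) auto
  qed
  also have "\<dots> \<le> liminf (\<lambda>n. \<integral>\<^sup>+ \<omega>. ennreal (Z n \<omega>) \<partial>M)"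
    using Zi by (intro nn_integral_liminf) auto
  also have "\<dots> \<le> limsup (\<lambda>n. \<integral>\<^sup>+ \<omega>. ennreal (Z n \<omega>) \<partial>M)"
    by (rule Liminf_le_Limsup) simp
  also have "\<dots> \<le> ennreal (exp (z * measure lborel B))"
    by (rule Limsup_bounded) (use Z_le in auto)
  finally have le: "(\<integral>\<^sup>+ \<omega>. ennreal ((1 + z) ^ pcount X B \<omega>) \<partial>M) \<le> ennreal (exp (z * measure lborel B))" .
  have meas: "(\<lambda>\<omega>. (1 + z) ^ pcount X B \<omega>) \<in> borel_measurable M" by measurable
  show int: "integrable M (\<lambda>\<omega>. (1 + z) ^ pcount X B \<omega>)"
    using le_less_trans[OF le] assms meas by (intro integrableI_nonneg) auto
  show "(\<integral>\<omega>. (1 + z) ^ pcount X B \<omega> \<partial>M) \<le> exp (z * measure lborel B)"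
    using le assms by (subst (asm) nn_integral_eq_integral[OF int]) auto
qed

lemma expectation_power_neg:
  assumes "0 \<le> s" "s < 1"
  shows "integrable M (\<lambda>\<omega>. (1 - s) ^ pcount X B \<omega>)"
    and "(\<integral>\<omega>. (1 - s) ^ pcount X B \<omega> \<partial>M) \<le> exp (- s * measure lborel B)"
proof -
  obtain m :: "nat \<Rightarrow> nat" and A :: "nat \<Rightarrow> nat \<Rightarrow> 'a set"
    where part: "\<And>n. dpp_partition M X K B b (m n) (A n)"
      and mesh: "\<And>n i x y. i < m n \<Longrightarrow> x \<in> A n i \<Longrightarrow> y \<in> A n i \<Longrightarrow> dist x y < 1 / Suc n"
    by (rule ex_fine_partitions) (rule that)
  define Z where "Z n \<omega> = (\<Prod>i<m n. 1 + (- s) * real (pcount X (A n i) \<omega>))" for n \<omega>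
  have Zi: "integrable M (Z n)" for n
    unfolding Z_def by (rule dpp_partition.expectation_prod_cells(1)[OF part])
  \<comment> \<open>The positive case with \<open>z = 1\<close> provides the majorant.\<close>
  have dom: "integrable M (\<lambda>\<omega>. 2 ^ pcount X B \<omega> :: real)"
    using expectation_power_pos(1)[of 1] by simp
  have meas: "(\<lambda>\<omega>. (1 - s) ^ pcount X B \<omega>) \<in> borel_measurable M" by measurable
  have lim: "AE \<omega> in M. (\<lambda>n. Z n \<omega>) \<longlonglongrightarrow> (1 - s) ^ pcount X B \<omega>"
  proof (rule AE_I2)
    fix \<omega> assume \<omega>: "\<omega> \<in> space M"
    have "\<forall>\<^sub>F n in sequentially. Z n \<omega> = (1 + (- s)) ^ pcount X B \<omega>"
      unfolding Z_def using part mesh \<omega> by (rule eventually_prod_cells_eq)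
    then show "(\<lambda>n. Z n \<omega>) \<longlonglongrightarrow> (1 - s) ^ pcount X B \<omega>"
      by (intro tendsto_eventually) simp
  qed
  have bound: "AE \<omega> in M. norm (Z n \<omega>) \<le> 2 ^ pcount X B \<omega>" for n
  proof (rule AE_I2)
    fix \<omega> assume "\<omega> \<in> space M"
    from dpp_partition.prod_cells_abs_le[OF part this, of "- s" n]
    show "norm (Z n \<omega>) \<le> 2 ^ pcount X B \<omega>"
      unfolding Z_def using assms by simp
  qed
  have Zm: "Z n \<in> borel_measurable M" for n using Zi by auto
  show "integrable M (\<lambda>\<omega>. (1 - s) ^ pcount X B \<omega>)"
    using meas Zm dom lim bound by (rule integrable_dominated_convergence)
  have conv: "(\<lambda>n. \<integral>\<omega>. Z n \<omega> \<partial>M) \<longlonglongrightarrow> (\<integral>\<omega>. (1 - s) ^ pcount X B \<omega> \<partial>M)"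
    using meas Zm dom lim bound by (rule integral_dominated_convergence)
  \<comment> \<open>Chosen so that \<open>\<eta>\<close> times the volume is at most
    \<open>1 - s\<close>; the Schur condition then holds since
    \<open>s * (2 - s) = 1 - (1 - s)^2\<close>. The added 1 keeps the denominator positive.\<close>
  define \<eta> where "\<eta> = (1 - s) / (1 + measure lborel B)"
  have \<eta>: "\<eta> > 0" using assms by (simp add: \<eta>_def add_pos_nonneg)
  have "\<eta> * measure lborel B \<le> \<eta> * (1 + measure lborel B)"
    using \<eta> by (intro mult_left_mono) auto
  also have "\<dots> = 1 - s"
    using add_pos_nonneg[OF zero_less_one measure_nonneg, of lborel B] by (simp add: \<eta>_def)
  finally have "\<eta> * measure lborel B \<le> 1 - s" .
  then have "s * (1 + \<eta> * measure lborel B) \<le> s * (1 + (1 - s))"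
    using assms(1) by (intro mult_left_mono) auto
  also have "\<dots> = 1 - (1 - s)\<^sup>2" by (simp add: power2_eq_square algebra_simps)
  also have "\<dots> \<le> 1" by simp
  finally have s\<eta>: "s * (1 + \<eta> * measure lborel B) \<le> 1" .
  \<comment> \<open>Uniform continuity converts a small mesh into oscillation below
    \<open>\<eta>\<close> on every cell, uniformly in the first argument.\<close>
  have "uniformly_continuous_on (B \<times> B) (\<lambda>(x, y). K x y)"
    using K_cont compact_B
    by (intro compact_uniformly_continuous compact_Times) (auto intro: continuous_on_subset)
  then obtain d where d: "d > 0"
    and K_d: "\<And>p q. p \<in> B \<times> B \<Longrightarrow> q \<in> B \<times> B \<Longrightarrow> dist q p < d \<Longrightarrow> dist (case q of (x, y) \<Rightarrow> K x y) (case p of (x, y) \<Rightarrow> K x y) < \<eta>"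
    using \<eta> unfolding uniformly_continuous_on_def by metis
  have "(\<lambda>n. 1 / real (Suc n)) \<longlonglongrightarrow> 0" by (rule LIMSEQ_Suc[OF lim_1_over_n])
  then have "\<forall>\<^sub>F n in sequentially. 1 / real (Suc n) < d" using d(1) by (rule order_tendstoD)
  then have "\<forall>\<^sub>F n in sequentially. (\<integral>\<omega>. Z n \<omega> \<partial>M) \<le> exp (- s * measure lborel B)"
  proof eventually_elim
    case (elim n)
    interpret P: dpp_partition M X K B b "m n" "A n" by (rule part)
    have "(\<integral>\<omega>. (\<Prod>i<m n. 1 - s * real (pcount X (A n i) \<omega>)) \<partial>M) \<le> exp (- s * measure lborel B)"
    proof (rule P.expectation_prod_le_neg[OF assms(1) less_imp_le[OF \<eta>] s\<eta>])
      fix x y y' i assume "x \<in> B" and i: "i < m n" and y: "y \<in> A n i" "y' \<in> A n i"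
      have "dist (x, y) (x, y') < d"
        using mesh[OF i y] elim by (simp add: dist_Pair_Pair)
      then have "dist (K x y) (K x y') < \<eta>"
        using K_d[of "(x, y')" "(x, y)"] \<open>x \<in> B\<close> y P.A_sub[OF i] by auto
      then show "K x y \<le> K x y' + \<eta>" by (simp add: dist_real_def)
    qed
    then show ?case by (simp add: Z_def)
  qed
  then show "(\<integral>\<omega>. (1 - s) ^ pcount X B \<omega> \<partial>M) \<le> exp (- s * measure lborel B)"
    using conv by (intro tendsto_upperbound[OF conv]) auto
qed

text \<open>First-order correlation for the partition of \<open>B\<close> into a single cell; the
  determinant is the diagonal value 1.\<close>

lemma expectation_pcount:
  "(\<integral>\<omega>. real (pcount X B \<omega>) \<partial>M) = measure lborel B"
proof -
  interpret P: dpp_partition M X K B b 1 "\<lambda>_. B"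
    by unfold_locales auto
  interpret C: prob_space P.cells by (rule P.prob_space_cells)
  have "det_on {0::nat} (\<lambda>i j. K (x i) (x j)) = 1" for x
    by (simp add: det_on_def K_diag)
  then show "(\<integral>\<omega>. real (pcount X B \<omega>) \<partial>M) = measure lborel B"
    using P.correlation_cells_integral(3)[of "{0}"] C.prob_space by simp
qed

end

section \<open>Bernstein bounds\<close>

text \<open>For \<open>x < 3\<close> this is
  \<open>exp x \<le> 1 + x + x^2 / (2 * (1 - x / 3))\<close> with denominators cleared. The
  difference of the sides vanishes at 0 with its first two derivatives, whose signs are
  \<open>h1\<close> and \<open>h2\<close>; its third derivative is
  \<open>2 * x * exp x\<close>.\<close>

lemma exp_bernstein_bound:
  fixes x :: real
  assumes "0 \<le> x"
  shows "(6 - 2 * x) * exp x \<le> 6 + 4 * x + x\<^sup>2"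
proof -
  have h2: "0 \<le> 2 - (2 - 2 * t) * exp t" if "0 \<le> t" for t :: real
  proof -
    have "2 - (2 - 2 * 0) * exp 0 \<le> 2 - (2 - 2 * t) * exp t"
    proof (rule DERIV_nonneg_imp_nondecreasing[OF that])
      fix u assume "0 \<le> u" "u \<le> t"
      then show "\<exists>y. ((\<lambda>t. 2 - (2 - 2 * t) * exp t) has_real_derivative y) (at u) \<and> 0 \<le> y"
        by (intro exI[of _ "2 * u * exp u"] conjI) (auto intro!: derivative_eq_intros simp: algebra_simps)
    qed
    then show ?thesis by simp
  qed
  have h1: "0 \<le> 4 + 2 * t - (4 - 2 * t) * exp t" if "0 \<le> t" for t :: real
  proof -
    have "4 + 2 * 0 - (4 - 2 * 0) * exp 0 \<le> 4 + 2 * t - (4 - 2 * t) * exp t"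
    proof (rule DERIV_nonneg_imp_nondecreasing[OF that])
      fix u assume u: "0 \<le> u" "u \<le> t"
      show "\<exists>y. ((\<lambda>t. 4 + 2 * t - (4 - 2 * t) * exp t) has_real_derivative y) (at u) \<and> 0 \<le> y"
        using h2[OF u(1)]
        by (intro exI[of _ "2 - (2 - 2 * u) * exp u"] conjI) (auto intro!: derivative_eq_intros simp: algebra_simps)
    qed
    then show ?thesis by simp
  qed
  have "6 + 4 * 0 + 0\<^sup>2 - (6 - 2 * 0) * exp 0 \<le> 6 + 4 * x + x\<^sup>2 - (6 - 2 * x) * exp x"
  proof (rule DERIV_nonneg_imp_nondecreasing[OF assms])
    fix u assume u: "0 \<le> u" "u \<le> x"
    show "\<exists>y. ((\<lambda>t. 6 + 4 * t + t\<^sup>2 - (6 - 2 * t) * exp t) has_real_derivative y) (at u) \<and> 0 \<le> y"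
      using h1[OF u(1)]
      by (intro exI[of _ "4 + 2 * u - (4 - 2 * u) * exp u"] conjI) (auto intro!: derivative_eq_intros simp: algebra_simps)
  qed
  then show ?thesis by simp
qed

lemma exp_minus_le_quadratic:
  fixes x :: real
  assumes "0 \<le> x"
  shows "exp (- x) \<le> 1 - x + x\<^sup>2 / 2"
proof -
  have "1 - 0 + 0\<^sup>2 / 2 - exp (- 0) \<le> 1 - x + x\<^sup>2 / 2 - exp (- x)"
  proof (rule DERIV_nonneg_imp_nondecreasing[OF assms])
    fix u assume "0 \<le> u" "u \<le> x"
    have "0 \<le> - 1 + u + exp (- u)" using exp_ge_add_one_self[of "- u"] by simp
    then show "\<exists>y. ((\<lambda>t. 1 - t + t\<^sup>2 / 2 - exp (- t)) has_real_derivative y) (at u) \<and> 0 \<le> y"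
      by (intro exI[of _ "- 1 + u + exp (- u)"] conjI) (auto intro!: derivative_eq_intros)
  qed
  then show ?thesis by simp
qed

text \<open>Both exponents are at most \<open>l\<^sup>2/(2(1 - l/3)) - l\<epsilon>\<close>; at this \<open>l\<close> that bound equals
  \<open>-l\<epsilon>/2\<close>.\<close>

lemma bernstein_exponents:
  fixes \<epsilon> :: real
  assumes "\<epsilon> > 0"
  defines "l \<equiv> 3 * \<epsilon> / (3 + \<epsilon>)"
  shows "exp l - 1 - l * (1 + \<epsilon>) \<le> - (3 * \<epsilon>\<^sup>2 / (6 + 2 * \<epsilon>))"
    and "exp (- l) - 1 + l * (1 - \<epsilon>) \<le> - (3 * \<epsilon>\<^sup>2 / (6 + 2 * \<epsilon>))"
proof -
  have l: "l > 0" using assms by (simp add: l_def)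
  have eps: "\<epsilon> = 3 * l / (3 - l)" "l < 3" using assms by (auto simp: l_def field_simps)
  have pos: "6 - 2 * l > 0" using eps by simp
  have rhs: "3 * \<epsilon>\<^sup>2 / (6 + 2 * \<epsilon>) = l * \<epsilon> / 2"
    using assms by (simp add: l_def field_simps power2_eq_square)
  have key: "3 * l\<^sup>2 / (6 - 2 * l) = l * \<epsilon> / 2"
    using eps(2) by (subst eps(1)) (simp add: field_simps power2_eq_square)
  have "exp l \<le> (6 + 4 * l + l\<^sup>2) / (6 - 2 * l)"
    using exp_bernstein_bound[of l] l pos by (simp add: pos_le_divide_eq mult.commute)
  also have "\<dots> = 1 + l + 3 * l\<^sup>2 / (6 - 2 * l)"
    using pos by (simp add: field_simps power2_eq_square)
  finally show "exp l - 1 - l * (1 + \<epsilon>) \<le> - (3 * \<epsilon>\<^sup>2 / (6 + 2 * \<epsilon>))"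
    unfolding rhs key by (simp add: algebra_simps)
  have "l\<^sup>2 / 2 = 3 * l\<^sup>2 / 6" by simp
  also have "\<dots> \<le> 3 * l\<^sup>2 / (6 - 2 * l)"
    using pos l by (intro divide_left_mono) auto
  also note key
  finally have "l\<^sup>2 / 2 \<le> l * \<epsilon> / 2" .
  then show "exp (- l) - 1 + l * (1 - \<epsilon>) \<le> - (3 * \<epsilon>\<^sup>2 / (6 + 2 * \<epsilon>))"
    unfolding rhs using exp_minus_le_quadratic[of l] l by (simp add: algebra_simps)
qed

section \<open>Chernoff's method for the two tails\<close>

context bounded_dpp
begin

lemma bernstein_upper:
  assumes "\<epsilon> > 0"
  shows "prob {\<omega> \<in> space M. (1 + \<epsilon>) * measure lborel B \<le> real (pcount X B \<omega>)}
    \<le> exp (- (3 * \<epsilon>\<^sup>2 / (6 + 2 * \<epsilon>)) * measure lborel B)"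
proof -
  let ?v = "measure lborel B"
  define l where "l = 3 * \<epsilon> / (3 + \<epsilon>)"
  have l: "l > 0" using assms by (simp add: l_def)
  \<comment> \<open>With \<open>z = exp l - 1\<close> the generating function becomes the moment
    generating function at \<open>l\<close>.\<close>
  have eq: "(1 + (exp l - 1)) ^ k = exp (l * real k)" for k
    using exp_of_nat_mult[of k l] by (simp add: mult.commute)
  have z: "0 \<le> exp l - 1" using l by simp
  note int = expectation_power_pos[OF z, unfolded eq]
  have "prob {\<omega> \<in> space M. (1 + \<epsilon>) * ?v \<le> real (pcount X B \<omega>)} =
      prob {\<omega> \<in> space M. exp (l * ((1 + \<epsilon>) * ?v)) \<le> exp (l * real (pcount X B \<omega>))}"
    using l by simp
  also have "\<dots> \<le> (\<integral>\<omega>. exp (l * real (pcount X B \<omega>)) \<partial>M) / exp (l * ((1 + \<epsilon>) * ?v))"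
    using int(1) by (intro integral_Markov_inequality_measure[where A = "{}"]) auto
  also have "\<dots> \<le> exp ((exp l - 1) * ?v) / exp (l * ((1 + \<epsilon>) * ?v))"
    using int(2) by (intro divide_right_mono) auto
  also have "\<dots> = exp ((exp l - 1 - l * (1 + \<epsilon>)) * ?v)"
    by (simp add: exp_diff[symmetric] algebra_simps)
  also have "\<dots> \<le> exp (- (3 * \<epsilon>\<^sup>2 / (6 + 2 * \<epsilon>)) * ?v)"
    unfolding exp_le_cancel_iff l_def using bernstein_exponents(1)[OF assms]
    by (rule mult_right_mono) simp
  finally show ?thesis .
qed

lemma bernstein_lower:
  assumes "\<epsilon> > 0"
  shows "prob {\<omega> \<in> space M. real (pcount X B \<omega>) \<le> (1 - \<epsilon>) * measure lborel B}
    \<le> exp (- (3 * \<epsilon>\<^sup>2 / (6 + 2 * \<epsilon>)) * measure lborel B)"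
proof -
  let ?v = "measure lborel B"
  define l where "l = 3 * \<epsilon> / (3 + \<epsilon>)"
  have l: "l > 0" using assms by (simp add: l_def)
  \<comment> \<open>For the lower tail \<open>s = 1 - exp (- l)\<close>, which is always below 1, as
    the bound for negative arguments requires.\<close>
  have eq: "(1 - (1 - exp (- l))) ^ k = exp (- l * real k)" for k
    using exp_of_nat_mult[of k "- l"] by (simp add: mult.commute)
  have z: "0 \<le> 1 - exp (- l)" "1 - exp (- l) < 1" using l by auto
  note int = expectation_power_neg[OF z, unfolded eq]
  have "prob {\<omega> \<in> space M. real (pcount X B \<omega>) \<le> (1 - \<epsilon>) * ?v} =
      prob {\<omega> \<in> space M. exp (- l * ((1 - \<epsilon>) * ?v)) \<le> exp (- l * real (pcount X B \<omega>))}"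
    using l by simp
  also have "\<dots> \<le> (\<integral>\<omega>. exp (- l * real (pcount X B \<omega>)) \<partial>M) / exp (- l * ((1 - \<epsilon>) * ?v))"
    using int(1) by (intro integral_Markov_inequality_measure[where A = "{}"]) auto
  also have "\<dots> \<le> exp (- (1 - exp (- l)) * ?v) / exp (- l * ((1 - \<epsilon>) * ?v))"
    using int(2) by (intro divide_right_mono) auto
  also have "\<dots> = exp ((exp (- l) - 1 + l * (1 - \<epsilon>)) * ?v)"
    by (simp add: exp_diff[symmetric] algebra_simps)
  also have "\<dots> \<le> exp (- (3 * \<epsilon>\<^sup>2 / (6 + 2 * \<epsilon>)) * ?v)"
    unfolding exp_le_cancel_iff l_def using bernstein_exponents(2)[OF assms]
    by (rule mult_right_mono) simp
  finally show ?thesis .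
qed

theorem bernstein_two_sided:
  assumes "\<epsilon> > 0" "measure lborel B > 0"
  shows "prob {\<omega> \<in> space M. \<bar>real (pcount X B \<omega>) / measure lborel B - 1\<bar> \<ge> \<epsilon>}
    \<le> 2 * exp (- (3 * \<epsilon>\<^sup>2 / (6 + 2 * \<epsilon>)) * measure lborel B)"
proof -
  let ?v = "measure lborel B"
  let ?U = "{\<omega> \<in> space M. (1 + \<epsilon>) * ?v \<le> real (pcount X B \<omega>)}"
  let ?L = "{\<omega> \<in> space M. real (pcount X B \<omega>) \<le> (1 - \<epsilon>) * ?v}"
  have "{\<omega> \<in> space M. \<bar>real (pcount X B \<omega>) / ?v - 1\<bar> \<ge> \<epsilon>} \<subseteq> ?U \<union> ?L"
  proof
    fix \<omega> assume "\<omega> \<in> {\<omega> \<in> space M. \<bar>real (pcount X B \<omega>) / ?v - 1\<bar> \<ge> \<epsilon>}"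
    then have \<omega>: "\<omega> \<in> space M"
      and "1 + \<epsilon> \<le> real (pcount X B \<omega>) / ?v \<or> real (pcount X B \<omega>) / ?v \<le> 1 - \<epsilon>"
      by (auto simp: abs_if split: if_splits)
    then show "\<omega> \<in> ?U \<union> ?L"
      using assms(2) by (auto simp: pos_le_divide_eq pos_divide_le_eq)
  qed
  moreover have [measurable]: "?U \<in> sets M" "?L \<in> sets M" by measurable
  ultimately have "prob {\<omega> \<in> space M. \<bar>real (pcount X B \<omega>) / ?v - 1\<bar> \<ge> \<epsilon>} \<le> prob (?U \<union> ?L)"
    by (intro finite_measure_mono) auto
  also have "\<dots> \<le> prob ?U + prob ?L" by (intro measure_Un_le) auto
  also have "\<dots> \<le> 2 * exp (- (3 * \<epsilon>\<^sup>2 / (6 + 2 * \<epsilon>)) * ?v)"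
    using bernstein_upper[OF assms(1)] bernstein_lower[OF assms(1)] by simp
  finally show ?thesis .
qed

end

section \<open>The Gaussian kernel on a Euclidean ball\<close>

theorem theorem2:
  fixes S :: "real^'n^'n" and M :: "'b measure" and X :: "'b \<Rightarrow> (real^'n) set"
    and R :: real
  assumes "pos_def_matrix S"
    and "(2 * pi) powr (real CARD('n) / 2) * sqrt (det S) = 1"
    and "is_DPP M X (gauss_kernel S)"
    and "R > 0"
  shows "(\<integral>\<omega>. real (pcount X (cball 0 R) \<omega>) \<partial>M) = measure lborel (cball (0::real^'n) R)
       \<and> measure lborel (cball (0::real^'n) R) = measure lborel (cball (0::real^'n) 1) * R ^ CARD('n)
       \<and> (\<forall>\<epsilon>>0. measure M {\<omega>\<in>space M.
              \<bar>real (pcount X (cball 0 R) \<omega>) / (\<integral>\<omega>. real (pcount X (cball 0 R) \<omega>) \<partial>M) - 1\<bar> \<ge> \<epsilon>}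
            \<le> 2 * exp (- (3 * \<epsilon>^2 / (6 + 2 * \<epsilon>)) * measure lborel (cball (0::real^'n) R)))"
proof -
  let ?B = "cball (0::real^'n) R"
  interpret bounded_dpp M X "gauss_kernel S" ?B 0
  proof unfold_locales
    show "is_DPP M X (gauss_kernel S)" by fact
    show "compact ?B" by (rule compact_cball)
    show "0 \<in> ?B" using assms(4) by simp
    show "continuous_on UNIV (\<lambda>(x, y). gauss_kernel S x y)"
      by (rule continuous_gauss_kernel[OF assms(1,2)])
    show "gauss_kernel S x x = 1" for x by (rule gauss_kernel_refl[OF assms(1,2)])
    show "0 \<le> gauss_kernel S x y" for x y by (rule gauss_kernel_nonneg[OF assms(1,2)])
    show "psd_on (I :: nat set) (\<lambda>i j. gauss_kernel S (p i) (p j))" for I p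
      by (rule psd_on_gauss_kernel[OF assms(1,2)])
    show "(\<integral>\<^sup>+ y. ennreal (gauss_kernel S x y) \<partial>lborel) \<le> 1" for x
      by (simp add: nn_integral_gauss_kernel[OF assms(1,2)])
  qed
  have vol: "measure lborel ?B = measure lborel (cball (0::real^'n) 1) * R ^ CARD('n)"
    using assms(4) by (simp add: content_cball)
  \<comment> \<open>Positivity allows the tail events for the quotient to be rewritten as tail
    events for the count.\<close>
  have "measure lborel ?B > 0"
    using assms(4) by (simp add: content_cball)
  then show ?thesis
    using vol bernstein_two_sided expectation_pcount by simp
qed

end
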